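(* There is a constant $C>1$ such that the following is true for sufficiently large $n$. Let $n^{-1}\ll p=p(n)\le \frac12$ and $M=M(n):=p\binom n2$. Furthermore, let $r=r(n)$ be a natural number satisfying $r\ll (pn)^{1/8}$, let $\omega=\omega(n)$ be any function tending to infinity with $n$, and set $$s_0:=C\cdot\omega\cdot r^4\cdot\sqrt{np^{-1}}.$$ Then $$\Pr\left[\exists\,\Pi:\ \mathrm{gap}(G_{n,M};\Pi)=r-1\ \text{ and }\ \mathrm{dist}(G_{n,M};\Pi)\ge s_0\right]\le\omega^{-1},$$ where $\Pi$ ranges over bipartitions of $[n]$.
   Context: $G_{n,M}$ is a graph chosen uniformly at random from all graphs on vertex set $[n]=\{1,\dots,n\}$ with exactly $M$ edges ($p$ is understood to be such that $M$ is an integer). The notation $f\ll g$ means $f(n)/g(n)\to0$ as $n\to\infty$. Natural numbers are positive, so $r\ge1$. "Sufficiently large $n$" means $n\ge n_0$, where $n_0$ may depend on the functions $p,r,\omega$, while $C$ is absolute. For a bipartition $\Pi=(A,B)$ of $[n]$ and a graph $G$ on $[n]$, $E(G;\Pi)$ is the set of edges of $G$ with one endpoint in $A$ and one in $B$. Let $b(G)=\max_\Pi|E(G;\Pi)|$; a bipartition attaining this maximum is called optimal. The gap of $\Pi$ is $\mathrm{gap}(G;\Pi):=b(G)-|E(G;\Pi)|$. The distance of two bipartitions $\Pi=(A,B)$, $\Pi'=(A',B')$ is $$\mathrm{dist}(\Pi,\Pi'):=\min\{|A'\cap A|+|B'\cap B|,\ |A'\cap B|+|B'\cap A|\}.$$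 Fix, for each $n$, a list of all bipartitions of $[n]$; the canonical optimal bipartition $\Pi^*(G)$ is the first bipartition on the list that is optimal for $G$. Set $\mathrm{dist}(G;\Pi):=\mathrm{dist}(\Pi,\Pi^*(G))$. *)

theory Defs
  imports "HOL-Probability.Probability" "HOL-Library.Ramsey"
begin

text \<open>A graph on the vertex set \<open>{1..n}\<close> is represented by its edge set, a set of
  two-element subsets of \<open>{1..n}\<close>; \<open>nsets V 2\<close> is the set of all two-element subsets of \<open>V\<close>.\<close>

definition graphs_with_edges :: "nat \<Rightarrow> nat \<Rightarrow> nat set set set" where
  "graphs_with_edges n m = {G. G \<subseteq> nsets {1..n} 2 \<and> card G = m}"

text \<open>\<open>pmf_of_set\<close> is meaningful only on a nonempty finite set, i.e. for \<open>m \<le> n choose 2\<close>.\<close>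

definition random_graph :: "nat \<Rightarrow> nat \<Rightarrow> nat set set pmf" where
  "random_graph n m = pmf_of_set (graphs_with_edges n m)"

text \<open>Bipartitions are ordered pairs, and a part may be empty. All notions below except
  \<open>opt_bipartition\<close> are invariant under swapping the parts; \<open>dist_bip\<close>, and hence
  \<open>dist_to_opt\<close>, does not see which of the two orders \<open>opt_bipartition\<close> picks.\<close>

definition bipartitions :: "nat \<Rightarrow> (nat set \<times> nat set) set" where
  "bipartitions n = {(A, B). A \<union> B = {1..n} \<and> A \<inter> B = {}}"

definition crossing_edges :: "nat set set \<Rightarrow> nat set \<times> nat set \<Rightarrow> nat set set" where
  "crossing_edges G P = {e \<in> G. \<exists>a\<in>fst P. \<exists>b\<in>snd P. e = {a, b}}"

definition max_cut :: "nat \<Rightarrow> nat set set \<Rightarrow> nat" where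
  "max_cut n G = Max ((\<lambda>P. card (crossing_edges G P)) ` bipartitions n)"

definition optimal :: "nat \<Rightarrow> nat set set \<Rightarrow> nat set \<times> nat set \<Rightarrow> bool" where
  "optimal n G P \<longleftrightarrow> P \<in> bipartitions n \<and> card (crossing_edges G P) = max_cut n G"

text \<open>The subtraction does not truncate when \<open>P \<in> bipartitions n\<close>.\<close>

definition gap :: "nat \<Rightarrow> nat set set \<Rightarrow> nat set \<times> nat set \<Rightarrow> nat" where
  "gap n G P = max_cut n G - card (crossing_edges G P)"

definition dist_bip :: "nat set \<times> nat set \<Rightarrow> nat set \<times> nat set \<Rightarrow> nat" where
  "dist_bip P Q =
     (case P of (A, B) \<Rightarrow> case Q of (A', B') \<Rightarrow>
        min (card (A' \<inter> A) + card (B' \<inter> B)) (card (A' \<inter> B) + card (B' \<inter> A)))"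

definition opt_bipartition ::
    "(nat set \<times> nat set) list \<Rightarrow> nat \<Rightarrow> nat set set \<Rightarrow> nat set \<times> nat set" where
  "opt_bipartition L n G = hd (filter (optimal n G) L)"

definition dist_to_opt ::
    "(nat set \<times> nat set) list \<Rightarrow> nat \<Rightarrow> nat set set \<Rightarrow> nat set \<times> nat set \<Rightarrow> nat" where
  "dist_to_opt L n G P = dist_bip P (opt_bipartition L n G)"

text \<open>Because \<open>x / 0 = 0\<close>, this is \<open>f = o(g)\<close> only when \<open>g\<close> is eventually nonzero.\<close>

definition much_less :: "(nat \<Rightarrow> real) \<Rightarrow> (nat \<Rightarrow> real) \<Rightarrow> bool" (infix "\<lless>" 50) where
  "f \<lless> g \<longleftrightarrow> (\<lambda>n. f n / g n) \<longlonglongrightarrow> 0"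

end

theory Submission
  imports Defs
begin

text \<open>
  The proof compares the largest cut of a uniformly random graph \<open>G\<close> with that of a perturbed copy
  of \<open>G\<close> which has the same distribution. Choose \<open>k\<close> distinct edges \<open>e i\<close> and \<open>k\<close> distinct
  non-edges \<open>f i\<close> at random, and for each \<open>i\<close> replace \<open>e i\<close> by \<open>f i\<close> or not according to a fair
  coin. For every fixed outcome of the coins this is an involution on the triples \<open>(G, e, f)\<close>, so
  the result is again uniform (lemma \<open>average_resample\<close>), and the expected size of the largest cut
  does not change. This expectation is now bounded from below. Write \<open>q\<close> for the square root of
  \<open>p n\<close>.

  Up to an event of exponentially small probability, no bipartition is crossed by more than
  \<open>2 n q\<close> edges in excess of its expectation (lemma \<open>union_tail_bound\<close>). A swap therefore costs
  a given cut only \<open>O(1 / q)\<close> edges on average, because the densities of the cut among the edges and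
  among the non-edges almost agree (lemma \<open>drift_ge\<close>). Following the canonical optimal
  bipartition alone, the largest cut loses at most \<open>O(k / q)\<close> in expectation.

  Suppose next that \<open>G\<close> has a second bipartition of gap \<open>r - 1\<close> at distance at least \<open>s\<close> from the
  optimal one. The two cuts differ on a set of order \<open>s n\<close> pairs, so that about \<open>k s / n\<close> of the
  swaps change the difference of their sizes. By Khinchine's inequality the difference then
  fluctuates by the square root of \<open>k s / n\<close>, and the larger of the two cuts exceeds their mean by
  half of that (lemma \<open>resample_max_meet_ge_two\<close>). If \<open>k\<close> is a large multiple of \<open>r^2 n / s\<close>, this
  gain is at least \<open>r\<close>, whereas the mean of the two cuts starts only \<open>(r - 1) / 2\<close> below the
  optimum; a net gain of at least \<open>r / 2\<close> remains.

  As the expectation is unchanged, gain and loss must balance: \<open>r / 2\<close> times the probability of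
  such a \<open>G\<close> is at most \<open>O(k / q)\<close> (theorem \<open>competing_maximizer_probability_le\<close>). For
  \<open>k = O(r^2 n / s)\<close> the probability is \<open>O(r n / (s q))\<close>, and \<open>n / q\<close> is the square root of \<open>n / p\<close>,
  so that for \<open>s\<close> as in the theorem it is less than \<open>1 / \<omega>\<close>. If that \<open>s\<close> exceeds \<open>n / 2\<close>,
  there is nothing to prove, as no two bipartitions are so far apart.

  Everything up to the section on bipartitions concerns a finite family of subsets of a finite
  set, and the size of the intersection of a random set \<open>G\<close> with the members of that family.
\<close>

section \<open>Averages over finite sets\<close>

definition average :: "'a set \<Rightarrow> ('a \<Rightarrow> real) \<Rightarrow> real" where
  "average S g = (\<Sum>x\<in>S. g x) / real (card S)"

lemma average_add: "average S (\<lambda>x. g x + h x) = average S g + average S h"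
  by (simp add: average_def sum.distrib add_divide_distrib)

lemma average_diff: "average S (\<lambda>x. g x - h x) = average S g - average S h"
  by (simp add: average_def sum_subtractf diff_divide_distrib)

lemma average_cmult: "average S (\<lambda>x. c * g x) = c * average S g"
  by (simp add: average_def sum_distrib_left)

lemma average_divide: "average S (\<lambda>x. g x / c) = average S g / c"
  by (simp add: average_def sum_divide_distrib mult.commute)

lemma average_sum: "average S (\<lambda>x. \<Sum>i\<in>I. g i x) = (\<Sum>i\<in>I. average S (g i))"
  by (simp add: average_def sum.swap[of _ I] sum_divide_distrib)

lemma average_const: "finite S \<Longrightarrow> S \<noteq> {} \<Longrightarrow> average S (\<lambda>_. c) = c"
  by (simp add: average_def)

lemma average_mono: "(\<And>x. x \<in> S \<Longrightarrow> g x \<le> h x) \<Longrightarrow> average S g \<le> average S h"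
  by (simp add: average_def divide_right_mono sum_mono)

lemma average_cong: "(\<And>x. x \<in> S \<Longrightarrow> g x = h x) \<Longrightarrow> average S g = average S h"
  by (simp add: average_def)

lemma average_Times:
  "average (S \<times> T) g = average S (\<lambda>x. average T (\<lambda>y. g (x, y)))"
proof -
  have "sum g (S \<times> T) = (\<Sum>x\<in>S. \<Sum>y\<in>T. g (x, y))"
    by (simp add: sum.cartesian_product)
  then show ?thesis
    by (simp add: average_def sum_divide_distrib[symmetric] mult.commute card_cartesian_product)
qed

lemma average_Times_mult:
  "average (S \<times> T) (\<lambda>z. g (fst z) * h (snd z)) = average S g * average T h"
  by (simp add: average_Times average_cmult mult.commute[of _ "average T h"])

lemma average_Times_fst:
  "finite T \<Longrightarrow> T \<noteq> {} \<Longrightarrow> average (S \<times> T) (\<lambda>z. g (fst z)) = average S g"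
  using average_Times_mult[of S T g "\<lambda>_. 1"] by (simp add: average_const)

lemma average_Times_snd:
  "finite S \<Longrightarrow> S \<noteq> {} \<Longrightarrow> average (S \<times> T) (\<lambda>z. h (snd z)) = average T h"
  using average_Times_mult[of S T "\<lambda>_. 1" h] by (simp add: average_const)

text \<open>A map all of whose fibres have the same size carries the uniform distribution to the
  uniform distribution.\<close>

lemma average_equidistributed:
  assumes "finite J" "finite D" and maps: "\<pi> ` J \<subseteq> D"
    and fibres: "\<And>a b. a \<in> D \<Longrightarrow> b \<in> D \<Longrightarrow> card {x\<in>J. \<pi> x = a} = card {x\<in>J. \<pi> x = b}"
    and "J \<noteq> {}"
  shows "average J (\<lambda>x. h (\<pi> x)) = average D h"
proof -
  obtain d where d: "d \<in> D" using assms by blast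
  define c where "c = card {x\<in>J. \<pi> x = d}"
  have group: "(\<Sum>x\<in>J. g (\<pi> x)) = real c * (\<Sum>a\<in>D. g a)" for g :: "_ \<Rightarrow> real"
  proof -
    have "(\<Sum>x\<in>J. g (\<pi> x)) = (\<Sum>a\<in>D. \<Sum>x\<in>{x\<in>J. \<pi> x = a}. g (\<pi> x))"
      by (rule sum.group[symmetric]) (use assms in auto)
    also have "\<dots> = (\<Sum>a\<in>D. real c * g a)"
    proof (rule sum.cong[OF refl])
      fix a assume "a \<in> D"
      then have "card {x\<in>J. \<pi> x = a} = c" unfolding c_def using d by (rule fibres)
      then show "(\<Sum>x\<in>{x\<in>J. \<pi> x = a}. g (\<pi> x)) = real c * g a" by simp
    qed
    finally show ?thesis by (simp add: sum_distrib_left)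
  qed
  have "real (card J) = real c * real (card D)"
    using group[of "\<lambda>_. 1"] by simp
  moreover have "card J > 0" using assms by (simp add: card_gt_0_iff)
  ultimately show ?thesis by (auto simp: average_def group)
qed

section \<open>Random signs\<close>

lemma sum_Pow_insert:
  fixes g :: "'a set \<Rightarrow> real"
  assumes "finite I" "x \<notin> I"
  shows "(\<Sum>s\<in>Pow (insert x I). g s) = (\<Sum>s\<in>Pow I. g s + g (insert x s))"
proof -
  have inj: "inj_on (insert x) (Pow I)"
    using assms by (intro inj_onI) (metis Diff_insert_absorb PowD subsetD)
  have "(\<Sum>s\<in>Pow (insert x I). g s) = (\<Sum>s\<in>Pow I. g s) + (\<Sum>s\<in>insert x ` Pow I. g s)"
    unfolding Pow_insert using assms by (intro sum.union_disjoint) auto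
  also have "(\<Sum>s\<in>insert x ` Pow I. g s) = (\<Sum>s\<in>Pow I. g (insert x s))"
    by (simp add: sum.reindex[OF inj])
  finally show ?thesis by (simp add: sum.distrib)
qed

lemma average_Pow_insert:
  assumes "finite I" "x \<notin> I"
  shows "average (Pow (insert x I)) g = average (Pow I) (\<lambda>s. (g s + g (insert x s)) / 2)"
  using assms
  by (simp add: average_def card_Pow sum_Pow_insert sum_divide_distrib[symmetric])

definition signed_sum :: "'i set \<Rightarrow> ('i \<Rightarrow> real) \<Rightarrow> 'i set \<Rightarrow> real" where
  "signed_sum I a s = (\<Sum>i\<in>I. if i \<in> s then a i else - a i)"

lemma signed_sum_insert:
  assumes "finite I" "x \<notin> I" "s \<subseteq> I"
  shows "signed_sum (insert x I) a s = signed_sum I a s - a x"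
    and "signed_sum (insert x I) a (insert x s) = signed_sum I a s + a x"
proof -
  show "signed_sum (insert x I) a s = signed_sum I a s - a x"
    using assms by (auto simp: signed_sum_def)
  have "(\<Sum>i\<in>I. if i \<in> insert x s then a i else - a i) = (\<Sum>i\<in>I. if i \<in> s then a i else - a i)"
    by (rule sum.cong) (use assms in auto)
  then show "signed_sum (insert x I) a (insert x s) = signed_sum I a s + a x"
    using assms by (simp add: signed_sum_def)
qed

text \<open>Turns a sum over a random subset into its expectation plus a symmetric fluctuation.\<close>

lemma sum_subset_eq_signed_sum:
  assumes "finite I" "s \<subseteq> I"
  shows "(\<Sum>i\<in>s. a i) = (\<Sum>i\<in>I. a i / 2) + signed_sum I (\<lambda>i. a i / 2) s"
proof -
  have "(\<Sum>i\<in>I. a i / 2) + signed_sum I (\<lambda>i. a i / 2) s = (\<Sum>i\<in>I. if i \<in> s then a i else 0)"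
    unfolding signed_sum_def sum.distrib[symmetric] by (rule sum.cong) auto
  also have "\<dots> = (\<Sum>i\<in>s. a i)"
    using assms by (simp add: sum.If_cases inf.absorb2)
  finally show ?thesis by simp
qed

lemma average_signed_sum: "finite I \<Longrightarrow> average (Pow I) (signed_sum I a) = 0"
proof (induction rule: finite_induct)
  case empty
  then show ?case by (simp add: average_def signed_sum_def)
next
  case (insert x I)
  have "average (Pow (insert x I)) (signed_sum (insert x I) a) = average (Pow I) (signed_sum I a)"
    unfolding average_Pow_insert[OF insert(1,2)]
    by (rule average_cong) (use insert in \<open>simp add: signed_sum_insert\<close>)
  then show ?case using insert by simp
qed

lemma average_signed_sum_power2:
  assumes "finite I"
  shows "average (Pow I) (\<lambda>s. signed_sum I a s ^ 2) = (\<Sum>i\<in>I. a i ^ 2)"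
  using assms
proof induction
  case empty
  then show ?case by (simp add: average_def signed_sum_def)
next
  case (insert x I)
  have "average (Pow (insert x I)) (\<lambda>s. signed_sum (insert x I) a s ^ 2)
      = average (Pow I) (\<lambda>s. signed_sum I a s ^ 2 + a x ^ 2)"
    unfolding average_Pow_insert[OF insert(1,2)]
    by (rule average_cong)
      (use insert in \<open>auto simp: signed_sum_insert power2_eq_square algebra_simps\<close>)
  also have "\<dots> = (\<Sum>i\<in>insert x I. a i ^ 2)"
    using insert by (simp add: average_add average_const Pow_not_empty)
  finally show ?case .
qed

text \<open>Write \<open>Q\<close> for the second moment. A further summand \<open>b\<close> with a random sign turns the fourth
  moment \<open>m\<close> into \<open>m + 6 b\<^sup>2 Q + b^4\<close>; the constant 3 makes this fit below \<open>3 (Q + b\<^sup>2)\<^sup>2\<close>.\<close>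

lemma average_signed_sum_power4:
  assumes "finite I"
  shows "average (Pow I) (\<lambda>s. signed_sum I a s ^ 4) \<le> 3 * (\<Sum>i\<in>I. a i ^ 2) ^ 2"
  using assms
proof induction
  case empty
  then show ?case by (simp add: average_def signed_sum_def)
next
  case (insert x I)
  let ?Q = "\<Sum>i\<in>I. a i ^ 2"
  have "average (Pow (insert x I)) (\<lambda>s. signed_sum (insert x I) a s ^ 4)
      = average (Pow I) (\<lambda>s. signed_sum I a s ^ 4 + 6 * a x ^ 2 * signed_sum I a s ^ 2 + a x ^ 4)"
    unfolding average_Pow_insert[OF insert(1,2)]
    by (rule average_cong)
      (use insert in \<open>auto simp: signed_sum_insert power4_eq_xxxx power2_eq_square algebra_simps\<close>)
  also have "\<dots> = average (Pow I) (\<lambda>s. signed_sum I a s ^ 4) + 6 * a x ^ 2 * ?Q + a x ^ 4"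
    using insert by (simp add: average_add average_const Pow_not_empty average_cmult average_signed_sum_power2)
  also have "\<dots> \<le> 3 * ?Q ^ 2 + 6 * a x ^ 2 * ?Q + 3 * a x ^ 4"
    using insert.IH by (intro add_mono) auto
  also have "\<dots> = 3 * (\<Sum>i\<in>insert x I. a i ^ 2) ^ 2"
    using insert by (simp add: power2_eq_square power4_eq_xxxx algebra_simps)
  finally show ?case .
qed

text \<open>Bounds a first absolute moment from below by a second and a fourth one. The bound is tight at
  \<open>u = c\<close>: the difference of the two sides is a multiple of \<open>u (u - c)\<^sup>2 (u + 2 c)\<close>.\<close>

lemma cubic_lower_bound:
  fixes u c :: real
  assumes "u \<ge> 0" "c > 0"
  shows "(3 * c^2 * u^2 - u^4) / (2 * c^3) \<le> u"
proof -
  have "0 \<le> u * (u - c)^2 * (u + 2 * c)" using assms by simp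
  also have "\<dots> = u^4 - 3 * c^2 * u^2 + u * (2 * c^3)"
    by (simp add: power2_eq_square power4_eq_xxxx power3_eq_cube algebra_simps)
  finally show ?thesis using assms by (simp add: pos_divide_le_eq)
qed

text \<open>With second moment \<open>Q\<close> and fourth moment at most \<open>3 Q\<^sup>2\<close>, the previous bound is best at
  \<open>c\<^sup>2 = 3 Q\<close>, where it gives the square root of \<open>Q / 3\<close>.\<close>

lemma khinchine:
  assumes "finite I"
  shows "sqrt ((\<Sum>i\<in>I. a i ^ 2) / 3) \<le> average (Pow I) (\<lambda>s. \<bar>signed_sum I a s\<bar>)"
proof (cases "(\<Sum>i\<in>I. a i ^ 2) = 0")
  case True
  have "0 \<le> average (Pow I) (\<lambda>s. \<bar>signed_sum I a s\<bar>)"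
    by (simp add: average_def sum_nonneg)
  then show ?thesis by (simp add: True)
next
  case False
  define Q where "Q = (\<Sum>i\<in>I. a i ^ 2)"
  have Q: "Q > 0" using False sum_nonneg[of I "\<lambda>i. a i ^ 2"] by (simp add: Q_def)
  define c where "c = sqrt (3 * Q)"
  have c: "c > 0" and c2: "c ^ 2 = 3 * Q" using Q by (auto simp: c_def)
  have "(3 * c^2 * Q - 3 * Q^2) / (2 * c^3)
      \<le> (3 * c^2 * Q - average (Pow I) (\<lambda>s. signed_sum I a s ^ 4)) / (2 * c^3)"
    using average_signed_sum_power4[OF assms, of a] c
    by (intro divide_right_mono) (auto simp: Q_def)
  also have "\<dots> = average (Pow I) (\<lambda>s. (3 * c^2 * \<bar>signed_sum I a s\<bar>^2 - \<bar>signed_sum I a s\<bar>^4) / (2 * c^3))"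
    by (simp add: average_divide average_diff average_cmult average_signed_sum_power2 assms Q_def
        power_even_abs)
  also have "\<dots> \<le> average (Pow I) (\<lambda>s. \<bar>signed_sum I a s\<bar>)"
    by (intro average_mono cubic_lower_bound) (use c in auto)
  finally have *: "(3 * c^2 * Q - 3 * Q^2) / (2 * c^3) \<le> average (Pow I) (\<lambda>s. \<bar>signed_sum I a s\<bar>)" .
  have "(3 * c^2 * Q - 3 * Q^2) / (2 * c^3) = Q / c"
    using c c2 by (simp add: field_simps power2_eq_square power3_eq_cube) 
  also have "\<dots> = sqrt (Q / 3)"
  proof -
    have "(Q / c)^2 = Q / 3" using Q by (simp only: power_divide c2) (simp add: power2_eq_square)
    then show ?thesis using Q c by (metis divide_nonneg_pos less_eq_real_def real_sqrt_unique)
  qed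
  finally show ?thesis using * by (simp add: Q_def)
qed

text \<open>Flipping all signs shows that \<open>d + S\<close> and \<open>d - S\<close> have the same mean absolute value, and
  \<open>\<bar>d + S\<bar> + \<bar>d - S\<bar> \<ge> 2 \<bar>S\<bar>\<close>.\<close>

lemma average_abs_shift_ge:
  assumes "finite I"
  shows "average (Pow I) (\<lambda>s. \<bar>signed_sum I a s\<bar>) \<le> average (Pow I) (\<lambda>s. \<bar>d + signed_sum I a s\<bar>)"
proof -
  have neg: "signed_sum I a (I - s) = - signed_sum I a s" for s
    unfolding signed_sum_def sum_negf[symmetric] by (rule sum.cong) auto
  have "(\<Sum>s\<in>Pow I. \<bar>d + signed_sum I a s\<bar>) = (\<Sum>s\<in>Pow I. \<bar>d - signed_sum I a s\<bar>)"
    by (rule sum.reindex_bij_witness[of _ "\<lambda>s. I - s" "\<lambda>s. I - s"]) (auto simp: neg double_diff)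
  then have "average (Pow I) (\<lambda>s. \<bar>d + signed_sum I a s\<bar>)
      = average (Pow I) (\<lambda>s. (\<bar>d + signed_sum I a s\<bar> + \<bar>d - signed_sum I a s\<bar>) / 2)"
    by (simp add: average_def sum.distrib sum_divide_distrib[symmetric])
  also have "\<dots> \<ge> average (Pow I) (\<lambda>s. \<bar>signed_sum I a s\<bar>)"
    by (rule average_mono) auto
  finally show ?thesis .
qed

section \<open>Sampling without replacement\<close>

definition samples :: "nat \<Rightarrow> 'a set \<Rightarrow> (nat \<Rightarrow> 'a) set" where
  "samples k T = {e \<in> {..<k} \<rightarrow>\<^sub>E T. inj_on e {..<k}}"

lemma finite_samples: "finite T \<Longrightarrow> finite (samples k T)"
  unfolding samples_def by (rule finite_subset[of _ "{..<k} \<rightarrow>\<^sub>E T"]) (auto intro: finite_PiE)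

lemma samples_nonempty:
  assumes "finite T" "k \<le> card T"
  shows "samples k T \<noteq> {}"
proof -
  obtain g where "g ` {..<k} \<subseteq> T" "inj_on g {..<k}"
    using card_le_inj[of "{..<k}" T] assms by auto
  then have "restrict g {..<k} \<in> samples k T"
    by (auto simp: samples_def inj_on_def)
  then show ?thesis by blast
qed

text \<open>Composing a sample with a permutation of \<open>T\<close> shows that the entries of a sample have a
  distribution invariant under all permutations of \<open>T\<close>.\<close>

lemma card_samples_fibre_le:
  assumes "finite T" and \<rho>: "\<rho> permutes T" and i: "i < k" and j: "j < k"
  shows "card {e \<in> samples k T. e i = a \<and> e j = b}
       \<le> card {e \<in> samples k T. e i = \<rho> a \<and> e j = \<rho> b}"
proof (rule card_inj_on_le[of "\<lambda>e. \<lambda>l\<in>{..<k}. \<rho> (e l)"])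
  have inj: "inj \<rho>" using \<rho> by (rule permutes_inj)
  show "inj_on (\<lambda>e. \<lambda>l\<in>{..<k}. \<rho> (e l)) {e \<in> samples k T. e i = a \<and> e j = b}"
  proof (rule inj_onI)
    fix e e'
    assume "e \<in> {e \<in> samples k T. e i = a \<and> e j = b}" "e' \<in> {e \<in> samples k T. e i = a \<and> e j = b}"
      and eq: "(\<lambda>l\<in>{..<k}. \<rho> (e l)) = (\<lambda>l\<in>{..<k}. \<rho> (e' l))"
    then have "e \<in> {..<k} \<rightarrow>\<^sub>E T" "e' \<in> {..<k} \<rightarrow>\<^sub>E T" by (auto simp: samples_def)
    then show "e = e'"
    proof (rule PiE_ext)
      fix l assume "l \<in> {..<k}"
      then have "\<rho> (e l) = \<rho> (e' l)" using fun_cong[OF eq, of l] by simp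
      then show "e l = e' l" by (rule injD[OF inj])
    qed
  qed
  show "(\<lambda>e. \<lambda>l\<in>{..<k}. \<rho> (e l)) ` {e \<in> samples k T. e i = a \<and> e j = b}
      \<subseteq> {e \<in> samples k T. e i = \<rho> a \<and> e j = \<rho> b}"
  proof (rule image_subsetI)
    fix e assume e: "e \<in> {e \<in> samples k T. e i = a \<and> e j = b}"
    have "(\<lambda>l\<in>{..<k}. \<rho> (e l)) \<in> {..<k} \<rightarrow>\<^sub>E T"
      using e permutes_in_image[OF \<rho>] by (auto simp: samples_def)
    moreover have "inj_on (\<lambda>l\<in>{..<k}. \<rho> (e l)) {..<k}"
      using e by (auto simp: samples_def inj_on_def dest: injD[OF inj])
    ultimately show "(\<lambda>l\<in>{..<k}. \<rho> (e l)) \<in> {e \<in> samples k T. e i = \<rho> a \<and> e j = \<rho> b}"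
      using e i j by (simp add: samples_def)
  qed
  show "finite {e \<in> samples k T. e i = \<rho> a \<and> e j = \<rho> b}"
    using finite_samples[OF assms(1)] by simp
qed

lemma card_samples_fibre_eq:
  assumes "finite T" and \<rho>: "\<rho> permutes T" and i: "i < k" and j: "j < k"
  shows "card {e \<in> samples k T. e i = a \<and> e j = b}
       = card {e \<in> samples k T. e i = \<rho> a \<and> e j = \<rho> b}"
proof (rule antisym)
  show "card {e \<in> samples k T. e i = a \<and> e j = b}
      \<le> card {e \<in> samples k T. e i = \<rho> a \<and> e j = \<rho> b}"
    by (rule card_samples_fibre_le[OF assms])
  show "card {e \<in> samples k T. e i = \<rho> a \<and> e j = \<rho> b}
      \<le> card {e \<in> samples k T. e i = a \<and> e j = b}"
    using card_samples_fibre_le[OF assms(1) permutes_inv[OF \<rho>] i j, of "\<rho> a" "\<rho> b"]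
    by (simp only: permutes_inverses(2)[OF \<rho>])
qed

lemma average_samples_one:
  assumes "finite T" "k \<le> card T" "i < k"
  shows "average (samples k T) (\<lambda>e. h (e i)) = average T h"
proof -
  have fibres: "card {e \<in> samples k T. e i = a} = card {e \<in> samples k T. e i = b}"
    if "a \<in> T" "b \<in> T" for a b
    using card_samples_fibre_eq[OF assms(1) permutes_swap_id[OF that] assms(3) assms(3), of a a]
    by simp
  have maps: "(\<lambda>e. e i) ` samples k T \<subseteq> T"
    using assms(3) by (auto simp: samples_def)
  show ?thesis
    by (rule average_equidistributed[OF finite_samples[OF assms(1)] assms(1) maps fibres
          samples_nonempty[OF assms(1,2)]])
qed

lemma average_samples_two:
  assumes "finite T" "k \<le> card T" "i < k" "j < k" "i \<noteq> j"
  shows "average (samples k T) (\<lambda>e. h (e i, e j)) = average (T \<times> T - Id) h"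
proof -
  have fibres: "card {e \<in> samples k T. (e i, e j) = x} = card {e \<in> samples k T. (e i, e j) = y}"
    if xy: "x \<in> T \<times> T - Id" "y \<in> T \<times> T - Id" for x y
  proof -
    obtain a b a' b' where ab: "x = (a, b)" "y = (a', b')" "a \<in> T" "b \<in> T" "a' \<in> T" "b' \<in> T"
      "a \<noteq> b" "a' \<noteq> b'" using xy by (cases x; cases y; simp)
    \<comment> \<open>The first transposition moves \<open>a\<close> to \<open>a'\<close>; the second one repairs the image of \<open>b\<close> and
      fixes \<open>a'\<close>.\<close>
    define \<rho> where "\<rho> = Transposition.transpose (Transposition.transpose a a' b) b' \<circ> Transposition.transpose a a'"
    have "Transposition.transpose a a' b \<in> T" using ab by (simp add: Transposition.transpose_def)
    then have "\<rho> permutes T"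
      unfolding \<rho>_def using ab by (intro permutes_compose permutes_swap_id)
    moreover have "\<rho> a = a'" "\<rho> b = b'"
      using ab by (auto simp: \<rho>_def Transposition.transpose_def)
    ultimately show ?thesis
      using card_samples_fibre_eq[OF assms(1) \<open>\<rho> permutes T\<close> assms(3,4), of a b] ab by simp
  qed
  have maps: "(\<lambda>e. (e i, e j)) ` samples k T \<subseteq> T \<times> T - Id"
    using assms(3-5) by (auto simp: samples_def inj_on_def)
  have fin: "finite (T \<times> T - Id)" using assms(1) by simp
  show ?thesis
    by (rule average_equidistributed[OF finite_samples[OF assms(1)] fin maps fibres
          samples_nonempty[OF assms(1,2)]])
qed

lemma average_samples_mem:
  assumes "finite T" "k \<le> card T" "i < k"
  shows "average (samples k T) (\<lambda>e. of_bool (e i \<in> A)) = real (card (T \<inter> A)) / real (card T)"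
proof -
  have "(\<Sum>x\<in>T. of_bool (x \<in> A)) = real (card (T \<inter> A))"
    using assms(1) by simp
  then show ?thesis
    unfolding average_samples_one[OF assms, of "\<lambda>x. of_bool (x \<in> A)"]
    by (simp only: average_def)
qed

text \<open>Without replacement, a second hit in \<open>A\<close> is at most as likely as the first one; this
  negative correlation lets variances be bounded as for independent entries.\<close>

lemma average_samples_mem_two:
  assumes "finite T" "k \<le> card T" "i < k" "j < k" "i \<noteq> j"
  shows "average (samples k T) (\<lambda>e. of_bool (e i \<in> A) * of_bool (e j \<in> A))
    \<le> (real (card (T \<inter> A)) / real (card T))^2"
proof -
  let ?a = "real (card (T \<inter> A))" and ?m = "real (card T)"
  have fin: "finite (T \<inter> A)" using assms by simp
  have m: "?m \<ge> 2" using assms by linarith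
  have am: "?a \<le> ?m" using assms by (simp add: card_mono)
  have diag: "card (B \<times> B \<inter> Id) = card B" for B :: "'a set"
  proof -
    have "B \<times> B \<inter> Id = (\<lambda>x. (x, x)) ` B" by auto
    then show ?thesis by (simp add: card_image inj_on_def)
  qed
  have offdiag: "real (card (B \<times> B - Id)) = real (card B) * real (card B) - real (card B)"
    if "finite B" for B :: "'a set"
  proof -
    have "card (B \<times> B - Id) + card (B \<times> B \<inter> Id) = card (B \<times> B)"
      using that by (metis card_Int_Diff finite_SigmaI add.commute)
    then show ?thesis unfolding diag card_cartesian_product of_nat_mult[symmetric] by linarith
  qed
  have "average (samples k T) (\<lambda>e. of_bool (e i \<in> A) * of_bool (e j \<in> A))
      = average (T \<times> T - Id) (\<lambda>(x, y). of_bool (x \<in> A) * of_bool (y \<in> A))"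
    using average_samples_two[OF assms, of "\<lambda>(x, y). of_bool (x \<in> A) * of_bool (y \<in> A)"] by simp
  also have "\<dots> = real (card ((T \<inter> A) \<times> (T \<inter> A) - Id)) / real (card (T \<times> T - Id))"
  proof -
    have "(\<Sum>z\<in>T \<times> T - Id. (case z of (x, y) \<Rightarrow> of_bool (x \<in> A) * of_bool (y \<in> A)))
        = (\<Sum>z\<in>T \<times> T - Id. of_bool (z \<in> A \<times> A) :: real)"
      by (rule sum.cong) auto
    also have "\<dots> = real (card ((T \<times> T - Id) \<inter> A \<times> A))"
      using assms(1) by simp
    also have "(T \<times> T - Id) \<inter> A \<times> A = (T \<inter> A) \<times> (T \<inter> A) - Id" by auto
    finally show ?thesis by (simp add: average_def)
  qed
  also have "\<dots> = (?a * ?a - ?a) / (?m * ?m - ?m)"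
    using offdiag[OF fin] offdiag[OF assms(1)] by simp
  also have "\<dots> \<le> (?a / ?m)^2"
  proof -
    have pos: "?m * ?m - ?m > 0" using m by (simp add: algebra_simps)
    have "(?a * ?a - ?a) * ?m^2 \<le> ?a^2 * (?m * ?m - ?m)"
      using mult_left_mono[OF am, of "?a * ?m"] by (simp add: power2_eq_square algebra_simps)
    then show ?thesis using pos m by (simp add: power_divide divide_simps)
  qed
  finally show ?thesis .
qed

section \<open>Swapping edges with non-edges\<close>

definition subsets_of_card :: "'a set \<Rightarrow> nat \<Rightarrow> 'a set set" where
  "subsets_of_card V m = {G. G \<subseteq> V \<and> card G = m}"

lemma finite_subsets_of_card: "finite V \<Longrightarrow> finite (subsets_of_card V m)"
  unfolding subsets_of_card_def by (rule finite_subset[of _ "Pow V"]) auto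

lemma card_subsets_of_card: "finite V \<Longrightarrow> card (subsets_of_card V m) = card V choose m"
  unfolding subsets_of_card_def by (rule n_subsets)

text \<open>The set \<open>s\<close> holds the indices whose coin asks for a swap.\<close>

definition swap_edges :: "'a set \<Rightarrow> (nat \<Rightarrow> 'a) \<Rightarrow> (nat \<Rightarrow> 'a) \<Rightarrow> nat set \<Rightarrow> 'a set" where
  "swap_edges G e f s = (G - e ` s) \<union> f ` s"

text \<open>After swapping, the entries of \<open>e\<close> and \<open>f\<close> at the indices in \<open>s\<close> trade places, so that \<open>e\<close>
  again lists edges and \<open>f\<close> non-edges of the new graph.\<close>

definition exchange :: "nat \<Rightarrow> nat set \<Rightarrow> (nat \<Rightarrow> 'a) \<Rightarrow> (nat \<Rightarrow> 'a) \<Rightarrow> nat \<Rightarrow> 'a" where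
  "exchange k s e f = (\<lambda>i\<in>{..<k}. if i \<in> s then f i else e i)"

lemma samplesD:
  assumes "e \<in> samples k G"
  shows "\<And>i. i < k \<Longrightarrow> e i \<in> G" "inj_on e {..<k}" "\<And>i. \<not> i < k \<Longrightarrow> e i = undefined"
proof -
  have e: "e \<in> {..<k} \<rightarrow>\<^sub>E G" using assms by (simp add: samples_def)
  show "\<And>i. i < k \<Longrightarrow> e i \<in> G" using PiE_mem[OF e] by simp
  show "inj_on e {..<k}" using assms by (simp add: samples_def)
  show "\<And>i. \<not> i < k \<Longrightarrow> e i = undefined" using PiE_arb[OF e] by simp
qed

lemma samplesI:
  assumes "\<And>i. i < k \<Longrightarrow> e i \<in> G" "\<And>i j. i < k \<Longrightarrow> j < k \<Longrightarrow> e i = e j \<Longrightarrow> i = j"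
    "\<And>i. \<not> i < k \<Longrightarrow> e i = undefined"
  shows "e \<in> samples k G"
proof -
  have "e \<in> {..<k} \<rightarrow>\<^sub>E G" using assms(1,3) by (intro PiE_I) auto
  moreover have "inj_on e {..<k}" using assms(2) by (intro inj_onI) auto
  ultimately show ?thesis by (simp add: samples_def)
qed

lemma exchange_simps:
  "i < k \<Longrightarrow> i \<in> s \<Longrightarrow> exchange k s e f i = f i"
  "i < k \<Longrightarrow> i \<notin> s \<Longrightarrow> exchange k s e f i = e i"
  "\<not> i < k \<Longrightarrow> exchange k s e f i = undefined"
  by (auto simp: exchange_def)

lemma exchange_exchange:
  assumes "e \<in> samples k G"
  shows "exchange k s (exchange k s e f) (exchange k s f e) = e"
proof
  fix i show "exchange k s (exchange k s e f) (exchange k s f e) i = e i"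
    by (cases "i < k"; cases "i \<in> s") (simp_all add: exchange_simps samplesD(3)[OF assms])
qed

lemma exchange_mem_samples:
  assumes e: "e \<in> samples k G" and f: "f \<in> samples k (V - G)"
    and GV: "G \<subseteq> V" and s: "s \<subseteq> {..<k}"
  shows "exchange k s e f \<in> samples k (swap_edges G e f s)"
    and "exchange k s f e \<in> samples k (V - swap_edges G e f s)"
proof -
  have ei: "e i \<in> G" if "i < k" for i using samplesD(1)[OF e that] .
  have fi: "f i \<in> V" "f i \<notin> G" if "i < k" for i using samplesD(1)[OF f that] by auto
  have ee: "e i = e j \<longleftrightarrow> i = j" if "i < k" "j < k" for i j
    using samplesD(2)[OF e] that by (auto simp: inj_on_def)
  have ff: "f i = f j \<longleftrightarrow> i = j" if "i < k" "j < k" for i j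
    using samplesD(2)[OF f] that by (auto simp: inj_on_def)
  have ef: "e i \<noteq> f j" if "i < k" "j < k" for i j
    using ei[OF that(1)] fi[OF that(2)] by auto
  have sk: "i < k" if "i \<in> s" for i using s that by auto
  show "exchange k s e f \<in> samples k (swap_edges G e f s)"
  proof (rule samplesI)
    fix i assume i: "i < k"
    show "exchange k s e f i \<in> swap_edges G e f s"
    proof (cases "i \<in> s")
      case False
      then have "e i \<notin> e ` s" using ee[OF i sk] by auto
      then show ?thesis using False i ei[OF i] by (simp add: exchange_simps swap_edges_def)
    qed (use i in \<open>simp add: exchange_simps swap_edges_def\<close>)
  next
    fix i j assume "i < k" "j < k" "exchange k s e f i = exchange k s e f j"
    then show "i = j"
      using ef[of i j] ef[of j i] ee[of i j] ff[of i j] 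
      by (cases "i \<in> s"; cases "j \<in> s") (auto simp: exchange_simps)
  qed (simp add: exchange_simps)
  show "exchange k s f e \<in> samples k (V - swap_edges G e f s)"
  proof (rule samplesI)
    fix i assume i: "i < k"
    show "exchange k s f e i \<in> V - swap_edges G e f s"
    proof (cases "i \<in> s")
      case True
      then have "e i \<notin> f ` s" using ef[OF i sk] by auto
      then show ?thesis using True i ei[OF i] GV by (auto simp: exchange_simps swap_edges_def)
    next
      case False
      then have "f i \<notin> f ` s" using ff[OF i sk] by auto
      then show ?thesis using False i fi[OF i] by (simp add: exchange_simps swap_edges_def)
    qed
  next
    fix i j assume "i < k" "j < k" "exchange k s f e i = exchange k s f e j"
    then show "i = j"
      using ef[of i j] ef[of j i] ee[of i j] ff[of i j] 
      by (cases "i \<in> s"; cases "j \<in> s") (auto simp: exchange_simps)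
  qed (simp add: exchange_simps)
qed

lemma image_exchange:
  "s \<subseteq> {..<k} \<Longrightarrow> exchange k s e f ` s = f ` s"
  by (rule image_cong) (auto simp: exchange_simps)

lemma swap_edges_exchange:
  assumes e: "e \<in> samples k G" and f: "f \<in> samples k (V - G)" and s: "s \<subseteq> {..<k}"
  shows "swap_edges (swap_edges G e f s) (exchange k s e f) (exchange k s f e) s = G"
proof -
  have "e ` s \<subseteq> G" "f ` s \<inter> G = {}"
    using samplesD(1)[OF e] samplesD(1)[OF f] s by auto
  then show ?thesis
    unfolding swap_edges_def image_exchange[OF s] by blast
qed

lemma card_swap_edges_Int:
  assumes e: "e \<in> samples k G" and f: "f \<in> samples k (V - G)" and s: "s \<subseteq> {..<k}" and "finite G"
  shows "real (card (swap_edges G e f s \<inter> c))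
    = real (card (G \<inter> c)) + (\<Sum>i\<in>s. of_bool (f i \<in> c) - of_bool (e i \<in> c))"
proof -
  have fs: "finite s" using s finite_subset by blast
  have sub: "e ` s \<subseteq> G" and disj: "f ` s \<inter> G = {}"
    using samplesD(1)[OF e] samplesD(1)[OF f] s by auto
  have inj: "inj_on e s" "inj_on f s"
    using samplesD(2)[OF e] samplesD(2)[OF f] s inj_on_subset by blast+
  have count: "real (card (g ` s \<inter> c)) = (\<Sum>i\<in>s. of_bool (g i \<in> c))" if "inj_on g s" for g :: "nat \<Rightarrow> 'a"
  proof -
    have "g ` s \<inter> c = g ` (s \<inter> {i. g i \<in> c})" by auto
    moreover have "inj_on g (s \<inter> {i. g i \<in> c})" by (rule inj_on_subset[OF that]) simp
    ultimately show ?thesis using fs by (simp add: card_image)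
  qed
  have "swap_edges G e f s \<inter> c = ((G \<inter> c) - (e ` s \<inter> c)) \<union> (f ` s \<inter> c)"
    by (auto simp: swap_edges_def)
  moreover have "card \<dots> = card ((G \<inter> c) - (e ` s \<inter> c)) + card (f ` s \<inter> c)"
    using fs disj \<open>finite G\<close> by (intro card_Un_disjoint) auto
  moreover have "card ((G \<inter> c) - (e ` s \<inter> c)) = card (G \<inter> c) - card (e ` s \<inter> c)"
    using fs sub by (intro card_Diff_subset) auto
  moreover have "card (e ` s \<inter> c) \<le> card (G \<inter> c)"
    using sub \<open>finite G\<close> by (intro card_mono) auto
  ultimately have "real (card (swap_edges G e f s \<inter> c))
      = real (card (G \<inter> c)) - real (card (e ` s \<inter> c)) + real (card (f ` s \<inter> c))"
    by simp
  then show ?thesis by (simp add: count inj sum_subtractf)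
qed

lemma swap_edges_mem:
  assumes G: "G \<in> subsets_of_card V m" and e: "e \<in> samples k G" and f: "f \<in> samples k (V - G)"
    and s: "s \<subseteq> {..<k}" and "finite V"
  shows "swap_edges G e f s \<in> subsets_of_card V m"
proof -
  have GV: "G \<subseteq> V" and m: "card G = m" using G by (auto simp: subsets_of_card_def)
  have fG: "finite G" using GV \<open>finite V\<close> finite_subset by blast
  have sub: "swap_edges G e f s \<subseteq> V"
    using samplesD(1)[OF f] s GV by (auto simp: swap_edges_def)
  have "of_bool (f i \<in> V) - of_bool (e i \<in> V) = (0 :: real)" if "i \<in> s" for i
    using samplesD(1)[OF e, of i] samplesD(1)[OF f, of i] s GV that by auto
  then have "real (card (swap_edges G e f s \<inter> V)) = real (card (G \<inter> V))"
    using card_swap_edges_Int[OF e f s fG, of V] by simp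
  moreover have "swap_edges G e f s \<inter> V = swap_edges G e f s" "G \<inter> V = G"
    using sub GV by blast+
  ultimately have "card (swap_edges G e f s) = m" using m by (simp only: of_nat_eq_iff)
  with sub show ?thesis unfolding subsets_of_card_def by blast
qed

text \<open>The conditional expectation of \<open>\<phi>\<close> after the random swaps, given the graph \<open>G\<close> before
  them.\<close>

definition resample :: "nat \<Rightarrow> 'a set \<Rightarrow> ('a set \<Rightarrow> real) \<Rightarrow> 'a set \<Rightarrow> real" where
  "resample k V \<phi> G = average (samples k G \<times> samples k (V - G))
     (\<lambda>z. average (Pow {..<k}) (\<lambda>s. \<phi> (swap_edges G (fst z) (snd z) s)))"

lemma card_samples: "finite T \<Longrightarrow> card (samples k T) = (\<Prod>i\<in>{0..<k}. card T - i)"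
  unfolding samples_def by (subst card_inj_on_subset_funcset)
    (simp_all only: card_lessThan diff_self_eq_0 power_0 mult_1 finite_lessThan order_refl)

text \<open>For fixed \<open>s\<close>, the swap together with \<open>exchange\<close> is an involution on the triples \<open>(G, e, f)\<close>,
  and all graphs with \<open>m\<close> edges occur in equally many triples.\<close>

lemma average_resample:
  assumes V: "finite V" and k: "k \<le> m" "m + k \<le> card V"
  shows "average (subsets_of_card V m) (resample k V \<phi>) = average (subsets_of_card V m) \<phi>"
proof -
  let ?\<G> = "subsets_of_card V m" and ?P = "\<lambda>G. samples k G \<times> samples k (V - G)"
  have fin: "finite ?\<G>" by (rule finite_subsets_of_card[OF V])
  have GD: "G \<subseteq> V" "card G = m" "finite G" "card (V - G) = card V - m" if "G \<in> ?\<G>" for G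
    using that V by (auto simp: subsets_of_card_def card_Diff_subset finite_subset)
  have fP: "finite (?P G)" if "G \<in> ?\<G>" for G
    using GD[OF that] V by (simp add: finite_samples)
  define w where "w = card (samples k {..<m}) * card (samples k {..<card V - m})"
  have cP: "card (?P G) = w" if "G \<in> ?\<G>" for G
  proof -
    have "card (samples k G) = card (samples k {..<m})"
      "card (samples k (V - G)) = card (samples k {..<card V - m})"
      using GD[OF that] V by (simp_all add: card_samples)
    then show ?thesis by (simp add: w_def card_cartesian_product)
  qed
  have one: "(\<Sum>G\<in>?\<G>. \<Sum>z\<in>?P G. \<phi> (swap_edges G (fst z) (snd z) s)) = real w * (\<Sum>G\<in>?\<G>. \<phi> G)"
    if s: "s \<subseteq> {..<k}" for s
  proof -
    let ?\<Phi> = "\<lambda>(G, e, f). (swap_edges G e f s, exchange k s e f, exchange k s f e)"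
    have "(\<Sum>G\<in>?\<G>. \<Sum>z\<in>?P G. \<phi> (swap_edges G (fst z) (snd z) s))
        = (\<Sum>(G, z)\<in>Sigma ?\<G> ?P. \<phi> (swap_edges G (fst z) (snd z) s))"
      by (rule sum.Sigma) (use fin fP in auto)
    also have "\<dots> = (\<Sum>(G, z)\<in>Sigma ?\<G> ?P. \<phi> G)"
    proof (rule sum.reindex_bij_witness[of _ ?\<Phi> ?\<Phi>])
      fix x assume "x \<in> Sigma ?\<G> ?P"
      then obtain G e f where x: "x = (G, e, f)" and G: "G \<in> ?\<G>"
        and e: "e \<in> samples k G" and f: "f \<in> samples k (V - G)" by auto
      show "?\<Phi> (?\<Phi> x) = x"
        using exchange_exchange[OF e] exchange_exchange[OF f] swap_edges_exchange[OF e f s]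
        by (simp add: x)
      show "?\<Phi> (?\<Phi> x) = x" by fact
      show "?\<Phi> x \<in> Sigma ?\<G> ?P"
        using swap_edges_mem[OF G e f s V] exchange_mem_samples[OF e f GD(1)[OF G] s] by (simp add: x)
      show "?\<Phi> x \<in> Sigma ?\<G> ?P" by fact
      show "(case ?\<Phi> x of (G, z) \<Rightarrow> \<phi> G) = (case x of (G, z) \<Rightarrow> \<phi> (swap_edges G (fst z) (snd z) s))"
        by (simp add: x)
    qed
    also have "\<dots> = (\<Sum>G\<in>?\<G>. \<Sum>z\<in>?P G. \<phi> G)"
      by (rule sum.Sigma[symmetric]) (use fin fP in auto)
    also have "\<dots> = real w * (\<Sum>G\<in>?\<G>. \<phi> G)"
      by (simp add: cP sum_distrib_left)
    finally show ?thesis .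
  qed
  have ne: "?P G \<noteq> {}" if "G \<in> ?\<G>" for G
    using samples_nonempty[of G k] samples_nonempty[of "V - G" k] GD[OF that] V k by auto
  show ?thesis
  proof (cases "?\<G> = {}")
    case False
    then obtain G0 where G0: "G0 \<in> ?\<G>" by blast
    have w: "w > 0" using ne[OF G0] fP[OF G0] cP[OF G0] by (metis card_gt_0_iff)
    have "(\<Sum>G\<in>?\<G>. resample k V \<phi> G)
        = (\<Sum>G\<in>?\<G>. \<Sum>z\<in>?P G. \<Sum>s\<in>Pow {..<k}. \<phi> (swap_edges G (fst z) (snd z) s)) / (w * 2^k)"
      by (simp add: resample_def average_def cP sum_divide_distrib[symmetric] card_Pow mult.commute)
    also have "(\<Sum>G\<in>?\<G>. \<Sum>z\<in>?P G. \<Sum>s\<in>Pow {..<k}. \<phi> (swap_edges G (fst z) (snd z) s))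
        = (\<Sum>s\<in>Pow {..<k}. \<Sum>G\<in>?\<G>. \<Sum>z\<in>?P G. \<phi> (swap_edges G (fst z) (snd z) s))"
      by (subst (2) sum.swap, subst sum.swap) simp
    also have "\<dots> = 2^k * real w * (\<Sum>G\<in>?\<G>. \<phi> G)"
      by (simp add: one card_Pow)
    finally have "(\<Sum>G\<in>?\<G>. resample k V \<phi> G) = (\<Sum>G\<in>?\<G>. \<phi> G)" using w by simp
    then show ?thesis by (simp add: average_def)
  qed (simp add: average_def)
qed

section \<open>The effect of resampling on the largest cut\<close>

definition max_meet :: "'a set set \<Rightarrow> 'a set \<Rightarrow> nat" where
  "max_meet \<C> G = Max ((\<lambda>c. card (G \<inter> c)) ` \<C>)"

text \<open>The expected change of \<open>card (G \<inter> c)\<close> under the random swaps: each of the \<open>k\<close> swaps happens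
  with probability one half, and then trades a random element of \<open>G\<close> for a random element of
  \<open>V - G\<close>.\<close>

definition drift :: "nat \<Rightarrow> 'a set \<Rightarrow> 'a set \<Rightarrow> 'a set \<Rightarrow> real" where
  "drift k V G c = real k / 2 *
     (real (card (c - G)) / real (card (V - G)) - real (card (G \<inter> c)) / real (card G))"

lemma mean_abs_le:
  fixes u w m :: real
  assumes "u \<le> m" "w \<le> m"
  shows "(u + w) / 2 + \<bar>u - w\<bar> / 2 \<le> m"
  using assms by (auto simp: abs_real_def field_simps)

locale swap_setting =
  fixes V G :: "'a set" and k :: nat
  assumes V: "finite V" and GV: "G \<subseteq> V" and kG: "k \<le> card G" and kV: "k \<le> card (V - G)"
begin

definition pairs :: "((nat \<Rightarrow> 'a) \<times> (nat \<Rightarrow> 'a)) set" where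
  "pairs = samples k G \<times> samples k (V - G)"

definition gains :: "'a set \<Rightarrow> (nat \<Rightarrow> 'a) \<times> (nat \<Rightarrow> 'a) \<Rightarrow> nat \<Rightarrow> real" where
  "gains c z i = of_bool (snd z i \<in> c) - of_bool (fst z i \<in> c)"

lemma finite_G: "finite G" "finite (V - G)"
  using V GV finite_subset by auto

lemma samples_nonempty_finite:
  "finite (samples k G)" "samples k G \<noteq> {}" "finite (samples k (V - G))" "samples k (V - G) \<noteq> {}"
  using finite_samples[OF finite_G(1)] finite_samples[OF finite_G(2)] samples_nonempty[OF finite_G(1) kG]
    samples_nonempty[OF finite_G(2) kV] by auto

lemma pairs_nonempty_finite: "finite pairs" "pairs \<noteq> {}"
  using samples_nonempty_finite by (auto simp: pairs_def)

lemma resample_eq: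
  "resample k V \<phi> G = average pairs (\<lambda>z. average (Pow {..<k}) (\<lambda>s. \<phi> (swap_edges G (fst z) (snd z) s)))"
  by (simp add: resample_def pairs_def)

text \<open>Given \<open>e\<close> and \<open>f\<close>, the size of the intersection with \<open>c\<close> is a constant plus a sum with
  independent random signs.\<close>

lemma card_swap_eq:
  assumes "z \<in> pairs" "s \<in> Pow {..<k}"
  shows "real (card (swap_edges G (fst z) (snd z) s \<inter> c))
    = real (card (G \<inter> c)) + (\<Sum>i<k. gains c z i / 2) + signed_sum {..<k} (\<lambda>i. gains c z i / 2) s"
proof -
  have "real (card (swap_edges G (fst z) (snd z) s \<inter> c)) = real (card (G \<inter> c)) + (\<Sum>i\<in>s. gains c z i)"
    unfolding gains_def
    by (rule card_swap_edges_Int[where V = V and k = k]) (use assms finite_G in \<open>auto simp: pairs_def\<close>)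
  then show ?thesis
    using sum_subset_eq_signed_sum[of "{..<k}" s "gains c z"] assms by simp
qed

lemma average_gains:
  assumes "c \<subseteq> V"
  shows "average pairs (\<lambda>z. \<Sum>i<k. gains c z i / 2) = drift k V G c"
proof -
  have one: "average pairs (\<lambda>z. gains c z i) = real (card (c - G)) / real (card (V - G)) - real (card (G \<inter> c)) / real (card G)"
    if "i < k" for i
  proof -
    have "(V - G) \<inter> c = c - G" using assms by auto
    then show ?thesis
      unfolding gains_def average_diff pairs_def
      using average_Times_snd[OF samples_nonempty_finite(1,2), of "samples k (V - G)" "\<lambda>f. of_bool (f i \<in> c)"]
        average_Times_fst[OF samples_nonempty_finite(3,4), of "samples k G" "\<lambda>f. of_bool (f i \<in> c)"]
        average_samples_mem[OF finite_G(1) kG that, of c] average_samples_mem[OF finite_G(2) kV that, of c]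
      by simp
  qed
  have "average pairs (\<lambda>z. \<Sum>i<k. gains c z i / 2) = (\<Sum>i<k. average pairs (\<lambda>z. gains c z i) / 2)"
    by (simp add: average_sum average_divide)
  also have "\<dots> = (\<Sum>i<k. (real (card (c - G)) / real (card (V - G)) - real (card (G \<inter> c)) / real (card G)) / 2)"
    by (rule sum.cong) (use one in auto)
  also have "\<dots> = drift k V G c" by (simp add: drift_def)
  finally show ?thesis .
qed

lemma max_meet_ge:
  assumes "finite \<C>" "c \<in> \<C>"
  shows "card (H \<inter> c) \<le> max_meet \<C> H"
  unfolding max_meet_def using assms by (intro Max_ge) auto

lemma resample_max_meet_ge:
  assumes C: "finite \<C>" "c \<in> \<C>" and "c \<subseteq> V"
  shows "real (card (G \<inter> c)) + drift k V G c \<le> resample k V (\<lambda>H. real (max_meet \<C> H)) G"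
proof -
  have "real (card (G \<inter> c)) + drift k V G c = average pairs (\<lambda>z. real (card (G \<inter> c)) + (\<Sum>i<k. gains c z i / 2))"
    using pairs_nonempty_finite by (simp add: average_add average_const average_gains[OF assms(3)])
  also have "\<dots> = average pairs (\<lambda>z. average (Pow {..<k})
      (\<lambda>s. real (card (G \<inter> c)) + (\<Sum>i<k. gains c z i / 2) + signed_sum {..<k} (\<lambda>i. gains c z i / 2) s))"
    by (simp add: average_add average_const Pow_not_empty average_signed_sum)
  also have "\<dots> \<le> resample k V (\<lambda>H. real (max_meet \<C> H)) G"
    unfolding resample_eq
    by (intro average_mono, subst card_swap_eq[symmetric]) (simp_all add: max_meet_ge[OF C])
  finally show ?thesis .
qed

text \<open>A sufficient condition for the \<open>i\<close>-th swap to change the difference of the intersections with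
  two sets whose symmetric difference is \<open>X\<close>: the added element lies in \<open>X\<close> and the removed one
  does not, so that no cancellation is possible.\<close>

definition hits :: "'a set \<Rightarrow> (nat \<Rightarrow> 'a) \<times> (nat \<Rightarrow> 'a) \<Rightarrow> nat \<Rightarrow> real" where
  "hits X z i = of_bool (fst z i \<in> - X) * of_bool (snd z i \<in> X)"

lemma hits_idem: "hits X z i * hits X z i = hits X z i"
  by (simp add: hits_def)

context
  fixes X :: "'a set" and a b \<mu> :: real
  assumes X: "X \<subseteq> V"
  defines "a \<equiv> real (card (G - X)) / real (card G)"
    and "b \<equiv> real (card (X - G)) / real (card (V - G))"
  defines "\<mu> \<equiv> real k * (a * b)"
begin

lemma average_hits:
  assumes "i < k"
  shows "average pairs (\<lambda>z. hits X z i) = a * b"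
proof -
  have eq: "(V - G) \<inter> X = X - G" "G \<inter> - X = G - X" using X by auto
  show ?thesis
    unfolding hits_def pairs_def
    using average_Times_mult[of "samples k G" "samples k (V - G)" "\<lambda>e. of_bool (e i \<in> - X)" "\<lambda>f. of_bool (f i \<in> X)"]
      average_samples_mem[OF finite_G(1) kG assms, of "- X"] average_samples_mem[OF finite_G(2) kV assms, of X]
    by (simp only: eq a_def b_def)
qed

lemma average_hits_mult:
  assumes "i < k" "j < k" "i \<noteq> j"
  shows "average pairs (\<lambda>z. hits X z i * hits X z j) \<le> (a * b)^2"
proof -
  have eq: "(V - G) \<inter> X = X - G" "G \<inter> - X = G - X" using X by auto
  have "average pairs (\<lambda>z. hits X z i * hits X z j) =
      average pairs (\<lambda>z. (of_bool (fst z i \<in> - X) * of_bool (fst z j \<in> - X)) * (of_bool (snd z i \<in> X) * of_bool (snd z j \<in> X)))"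
    unfolding hits_def by (rule average_cong) (simp only: mult_ac)
  also have "\<dots> = average (samples k G) (\<lambda>e. of_bool (e i \<in> - X) * of_bool (e j \<in> - X))
      * average (samples k (V - G)) (\<lambda>f. of_bool (f i \<in> X) * of_bool (f j \<in> X))"
    unfolding pairs_def
    using average_Times_mult[of "samples k G" "samples k (V - G)"
        "\<lambda>e. of_bool (e i \<in> - X) * of_bool (e j \<in> - X)" "\<lambda>f. of_bool (f i \<in> X) * of_bool (f j \<in> X)"]
    by (simp only:)
  also have "\<dots> \<le> a^2 * b^2"
  proof (rule mult_mono)
    show "average (samples k G) (\<lambda>e. of_bool (e i \<in> - X) * of_bool (e j \<in> - X)) \<le> a^2"
      using average_samples_mem_two[OF finite_G(1) kG assms, of "- X"] by (simp only: eq a_def)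
    show "average (samples k (V - G)) (\<lambda>f. of_bool (f i \<in> X) * of_bool (f j \<in> X)) \<le> b^2"
      using average_samples_mem_two[OF finite_G(2) kV assms, of X] by (simp only: eq b_def)
    show "0 \<le> average (samples k (V - G)) (\<lambda>f. of_bool (f i \<in> X) * of_bool (f j \<in> X))"
      by (simp add: average_def sum_nonneg)
  qed simp
  finally show ?thesis by (simp only: power_mult_distrib)
qed

lemma average_hits_sum: "average pairs (\<lambda>z. \<Sum>i<k. hits X z i) = \<mu>"
proof -
  have "average pairs (\<lambda>z. \<Sum>i<k. hits X z i) = (\<Sum>i<k. average pairs (\<lambda>z. hits X z i))"
    by (rule average_sum)
  also have "\<dots> = (\<Sum>i<k. a * b)" by (rule sum.cong) (simp_all add: average_hits)
  finally show ?thesis by (simp add: \<mu>_def)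
qed

text \<open>The variance of the number of hits is at most its mean, since distinct hits are negatively
  correlated.\<close>

lemma average_hits_sum_power2: "average pairs (\<lambda>z. (\<Sum>i<k. hits X z i)^2) \<le> \<mu> + \<mu>^2"
proof -
  have "average pairs (\<lambda>z. (\<Sum>i<k. hits X z i)^2) = (\<Sum>i<k. \<Sum>j<k. average pairs (\<lambda>z. hits X z i * hits X z j))"
    by (simp only: power2_eq_square sum_product average_sum)
  also have "\<dots> \<le> (\<Sum>i<k. \<Sum>j<k. (if i = j then a * b else 0) + (a * b)^2)"
  proof (intro sum_mono)
    fix i j assume "i \<in> {..<k}" "j \<in> {..<k}"
    then show "average pairs (\<lambda>z. hits X z i * hits X z j) \<le> (if i = j then a * b else 0) + (a * b)^2"
      using average_hits_mult[of i j] average_hits[of i] by (cases "i = j") (simp_all add: hits_idem)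
  qed
  also have "\<dots> = \<mu> + \<mu>^2"
    by (simp add: sum.distrib \<mu>_def power2_eq_square algebra_simps)
  finally show ?thesis .
qed

text \<open>The mean of the root is close to the root of the mean, because the number of hits is
  concentrated; here \<open>cubic_lower_bound\<close> is applied to the root of the number of hits.\<close>

lemma average_sqrt_hits:
  assumes "\<mu> > 0"
  shows "sqrt \<mu> * (1 - 1 / (2 * \<mu>)) \<le> average pairs (\<lambda>z. sqrt (\<Sum>i<k. hits X z i))"
proof -
  let ?Y = "\<lambda>z. \<Sum>i<k. hits X z i"
  define c where "c = sqrt \<mu>"
  have c: "c > 0" and c2: "c^2 = \<mu>" using assms by (auto simp: c_def)
  have Y0: "?Y z \<ge> 0" for z by (rule sum_nonneg) (simp add: hits_def)
  have pt: "(3 * \<mu> * ?Y z - (?Y z)^2) / (2 * c^3) \<le> sqrt (?Y z)" for z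
  proof -
    have "sqrt (?Y z) ^ 4 = (?Y z)^2"
      using Y0[of z] by (metis mult_2_right numeral_Bit0 power2_eq_square power_add real_sqrt_pow2)
    then show ?thesis
      using cubic_lower_bound[of "sqrt (?Y z)" c] c Y0[of z] by (simp add: c2)
  qed
  have "sqrt \<mu> * (1 - 1 / (2 * \<mu>)) = (3 * \<mu> * \<mu> - (\<mu> + \<mu>^2)) / (2 * c^3)"
    unfolding c_def[symmetric] c2[symmetric] using c
    by (simp add: field_simps power2_eq_square power3_eq_cube)
  also have "\<dots> \<le> (3 * \<mu> * average pairs ?Y - average pairs (\<lambda>z. (?Y z)^2)) / (2 * c^3)"
    using average_hits_sum_power2 c by (intro divide_right_mono) (auto simp: average_hits_sum)
  also have "\<dots> = average pairs (\<lambda>z. (3 * \<mu> * ?Y z - (?Y z)^2) / (2 * c^3))"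
    by (simp only: average_divide average_diff average_cmult)
  also have "\<dots> \<le> average pairs (\<lambda>z. sqrt (?Y z))"
    by (intro average_mono pt)
  finally show ?thesis .
qed

end

text \<open>After the swaps the maximum is at least the larger of the two intersections, that is, their
  mean plus half the absolute value of their difference. The difference is a constant plus a signed
  sum in which every hit contributes a coefficient of absolute value at least one half, and
  Khinchine's inequality applies.\<close>

lemma resample_max_meet_ge_two:
  assumes C: "finite \<C>" "c \<in> \<C>" "d \<in> \<C>" and cd: "c \<subseteq> V" "d \<subseteq> V"
  defines "X \<equiv> sym_diff c d"
  defines "\<mu> \<equiv> real k * (real (card (G - X)) / real (card G) * (real (card (X - G)) / real (card (V - G))))"
  assumes mu: "\<mu> > 0"
  shows "(real (card (G \<inter> c)) + drift k V G c + (real (card (G \<inter> d)) + drift k V G d)) / 2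
      + sqrt \<mu> * (1 - 1 / (2 * \<mu>)) / 7 \<le> resample k V (\<lambda>H. real (max_meet \<C> H)) G"
proof -
  let ?U = "\<lambda>z s. real (card (swap_edges G (fst z) (snd z) s \<inter> c))"
  let ?W = "\<lambda>z s. real (card (swap_edges G (fst z) (snd z) s \<inter> d))"
  have XV: "X \<subseteq> V" using cd by (auto simp: X_def)
  have inner: "(real (card (G \<inter> c)) + (\<Sum>i<k. gains c z i / 2) + (real (card (G \<inter> d)) + (\<Sum>i<k. gains d z i / 2))) / 2
      + sqrt (\<Sum>i<k. hits X z i) / 7 \<le> average (Pow {..<k}) (\<lambda>s. real (max_meet \<C> (swap_edges G (fst z) (snd z) s)))"
    if z: "z \<in> pairs" for z
  proof -
    define \<gamma> where "\<gamma> i = (gains c z i - gains d z i) / 2" for i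
    define D where "D = real (card (G \<inter> c)) + (\<Sum>i<k. gains c z i / 2) - (real (card (G \<inter> d)) + (\<Sum>i<k. gains d z i / 2))"
    define S where "S = real (card (G \<inter> c)) + (\<Sum>i<k. gains c z i / 2) + (real (card (G \<inter> d)) + (\<Sum>i<k. gains d z i / 2))"
    let ?\<epsilon> = "signed_sum {..<k}"
    have diff: "?\<epsilon> \<gamma> s = ?\<epsilon> (\<lambda>i. gains c z i / 2) s - ?\<epsilon> (\<lambda>i. gains d z i / 2) s" for s
      unfolding signed_sum_def sum_subtractf[symmetric]
      by (rule sum.cong) (auto simp: \<gamma>_def field_simps)
    have hit: "hits X z i / 4 \<le> (\<gamma> i)^2" for i
      by (auto simp: hits_def \<gamma>_def gains_def X_def power2_eq_square)
    \<comment> \<open>The constant 7 is the square root of \<open>48 = 3 * 4 * 4\<close>, rounded up: 3 is Khinchine's constant,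
      one factor 4 the square of the coefficient one half, the other the square of the half in front
      of the absolute value.\<close>
    have "sqrt (\<Sum>i<k. hits X z i) / 7 = sqrt ((\<Sum>i<k. hits X z i) / 49)"
      by (simp add: real_sqrt_divide)
    also have "\<dots> \<le> sqrt ((\<Sum>i<k. (\<gamma> i)^2) / 3 / 4)"
    proof (rule real_sqrt_le_mono)
      have "(\<Sum>i<k. hits X z i) / 4 \<le> (\<Sum>i<k. (\<gamma> i)^2)"
        unfolding sum_divide_distrib by (intro sum_mono hit)
      moreover have "0 \<le> (\<Sum>i<k. hits X z i)" by (rule sum_nonneg) (simp add: hits_def)
      ultimately show "(\<Sum>i<k. hits X z i) / 49 \<le> (\<Sum>i<k. (\<gamma> i)^2) / 3 / 4" by linarith
    qed
    also have "\<dots> = sqrt ((\<Sum>i<k. (\<gamma> i)^2) / 3) / 2" by (simp only: real_sqrt_divide real_sqrt_four)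
    also have "\<dots> \<le> average (Pow {..<k}) (\<lambda>s. \<bar>D + ?\<epsilon> \<gamma> s\<bar>) / 2"
      using khinchine[of "{..<k}" \<gamma>] average_abs_shift_ge[of "{..<k}" \<gamma> D] by simp
    finally have kh: "sqrt (\<Sum>i<k. hits X z i) / 7 \<le> average (Pow {..<k}) (\<lambda>s. \<bar>D + ?\<epsilon> \<gamma> s\<bar>) / 2" .
    have "S / 2 + sqrt (\<Sum>i<k. hits X z i) / 7
        \<le> average (Pow {..<k}) (\<lambda>s. (S + ?\<epsilon> (\<lambda>i. gains c z i / 2) s + ?\<epsilon> (\<lambda>i. gains d z i / 2) s) / 2
            + \<bar>D + ?\<epsilon> \<gamma> s\<bar> / 2)"
      using kh by (simp add: average_add average_divide average_const Pow_not_empty average_signed_sum)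
    also have "\<dots> \<le> average (Pow {..<k}) (\<lambda>s. real (max_meet \<C> (swap_edges G (fst z) (snd z) s)))"
    proof (rule average_mono)
      fix s assume s: "s \<in> Pow {..<k}"
      let ?m = "real (max_meet \<C> (swap_edges G (fst z) (snd z) s))"
      have "?U z s \<le> ?m" "?W z s \<le> ?m"
        using max_meet_ge[OF C(1,2)] max_meet_ge[OF C(1,3)] by simp_all
      then have "(?U z s + ?W z s) / 2 + \<bar>?U z s - ?W z s\<bar> / 2 \<le> ?m" by (rule mean_abs_le)
      then show "(S + ?\<epsilon> (\<lambda>i. gains c z i / 2) s + ?\<epsilon> (\<lambda>i. gains d z i / 2) s) / 2
            + \<bar>D + ?\<epsilon> \<gamma> s\<bar> / 2 \<le> ?m"
        unfolding card_swap_eq[OF z s] diff S_def D_def by (simp add: algebra_simps)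
    qed
    finally show ?thesis unfolding S_def .
  qed
  have "(real (card (G \<inter> c)) + drift k V G c + (real (card (G \<inter> d)) + drift k V G d)) / 2
      + sqrt \<mu> * (1 - 1 / (2 * \<mu>)) / 7
      \<le> (real (card (G \<inter> c)) + drift k V G c + (real (card (G \<inter> d)) + drift k V G d)) / 2
      + average pairs (\<lambda>z. sqrt (\<Sum>i<k. hits X z i)) / 7"
    using average_sqrt_hits[OF XV] mu unfolding \<mu>_def by simp
  also have "\<dots> = average pairs (\<lambda>z. (real (card (G \<inter> c)) + (\<Sum>i<k. gains c z i / 2) + (real (card (G \<inter> d)) + (\<Sum>i<k. gains d z i / 2))) / 2
      + sqrt (\<Sum>i<k. hits X z i) / 7)"
    by (simp only: average_add average_divide average_const[OF pairs_nonempty_finite] average_gains[OF cd(1)]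
        average_gains[OF cd(2)])
  also have "\<dots> \<le> resample k V (\<lambda>H. real (max_meet \<C> H)) G"
    unfolding resample_eq by (intro average_mono inner)
  finally show ?thesis .
qed

text \<open>Each swap removes at most one element from the best member of the family. This crude bound
  covers the rare sets \<open>G\<close> without good control of the drift.\<close>

lemma resample_max_meet_ge_minus:
  assumes C: "finite \<C>" "\<C> \<noteq> {}"
  shows "real (max_meet \<C> G) - real k \<le> resample k V (\<lambda>H. real (max_meet \<C> H)) G"
proof -
  have "max_meet \<C> G \<in> (\<lambda>c. card (G \<inter> c)) ` \<C>"
    unfolding max_meet_def using C by (intro Max_in) auto
  then obtain c where c: "c \<in> \<C>" "max_meet \<C> G = card (G \<inter> c)" by auto
  have "real (max_meet \<C> G) - real k = average pairs (\<lambda>z. average (Pow {..<k}) (\<lambda>s. real (max_meet \<C> G) - real k))"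
    using pairs_nonempty_finite by (simp add: average_const Pow_not_empty)
  also have "\<dots> \<le> resample k V (\<lambda>H. real (max_meet \<C> H)) G"
    unfolding resample_eq
  proof (intro average_mono)
    fix z s assume z: "z \<in> pairs" and s: "s \<in> Pow {..<k}"
    have "(\<Sum>i\<in>s. -1) \<le> (\<Sum>i\<in>s. gains c z i)" by (rule sum_mono) (simp add: gains_def)
    moreover have "card s \<le> k" using s card_mono[of "{..<k}" s] by simp
    moreover have "real (card (swap_edges G (fst z) (snd z) s \<inter> c)) = real (card (G \<inter> c)) + (\<Sum>i\<in>s. gains c z i)"
      unfolding gains_def
      by (rule card_swap_edges_Int[where V = V and k = k]) (use z s finite_G in \<open>auto simp: pairs_def\<close>)
    moreover have "real (card (swap_edges G (fst z) (snd z) s \<inter> c)) \<le> real (max_meet \<C> (swap_edges G (fst z) (snd z) s))"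
      using max_meet_ge[OF C(1) c(1)] by simp
    ultimately show "real (max_meet \<C> G) - real k \<le> real (max_meet \<C> (swap_edges G (fst z) (snd z) s))"
      using c(2) by simp
  qed
  finally show ?thesis .
qed

end

text \<open>With \<open>m = card G\<close> and \<open>p = m / card V\<close>, the drift of \<open>c\<close> equals
  \<open>- k (card (G \<inter> c) - p card c) / (2 m (1 - p))\<close>, and \<open>1 - p \<ge> 1 / 2\<close>.\<close>

lemma drift_ge:
  assumes "finite V" "G \<subseteq> V" "c \<subseteq> V" and G: "card G > 0" "2 * card G \<le> card V" and "t \<ge> 0"
    and x: "real (card (G \<inter> c)) \<le> real (card G) / real (card V) * real (card c) + t"
  shows "- (real k * t / real (card G)) \<le> drift k V G c"
proof -
  define M N x' c' where "M = real (card G)" and "N = real (card V)"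
    and "x' = real (card (G \<inter> c))" and "c' = real (card c)"
  have fin: "finite c" "finite G" using assms finite_subset by auto
  have N: "M > 0" "2 * M \<le> N" using G by (auto simp: M_def N_def)
  have "card (c - G) = card c - card (G \<inter> c)" "card (G \<inter> c) \<le> card c"
    using fin by (auto simp: card_Diff_subset_Int Int_commute intro: card_mono)
  then have 1: "real (card (c - G)) = c' - x'" by (simp add: c'_def x'_def)
  have 2: "real (card (V - G)) = N - M"
    using assms fin G by (simp add: card_Diff_subset N_def M_def)
  have "x' * N \<le> M * c' + t * N" using x N by (simp add: x'_def c'_def M_def[symmetric] N_def[symmetric] field_simps)
  moreover have "t * N \<le> t * (2 * (N - M))" using N \<open>t \<ge> 0\<close> by (intro mult_left_mono) auto
  ultimately have "- (2 * t * (N - M)) \<le> M * c' - N * x'" by (simp add: algebra_simps)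
  then have "- (2 * t * (N - M)) / (M * (N - M)) \<le> (M * c' - N * x') / (M * (N - M))"
    using N by (intro divide_right_mono) auto
  also have "(M * c' - N * x') / (M * (N - M)) = (c' - x') / (N - M) - x' / M"
    using N by (simp add: field_simps)
  also have "- (2 * t * (N - M)) / (M * (N - M)) = - (2 * t / M)"
    using N by (simp add: field_simps)
  finally have "real k / 2 * - (2 * t / M) \<le> real k / 2 * ((c' - x') / (N - M) - x' / M)"
    by (rule mult_left_mono) simp
  then show ?thesis
    by (simp add: drift_def 1 2 x'_def[symmetric] M_def[symmetric])
qed

text \<open>The balance of gain and loss. The sets in \<open>\<T>\<close> are the typical ones, those in \<open>\<B>\<close> are typical
  and have a near-maximizer \<open>d\<close> that competes with a maximizer \<open>c\<close>; the last condition says that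
  the expected number of hits is at least \<open>64 r\<^sup>2\<close>. Resampling changes the maximum on average by at
  least \<open>r / 2 - k t / m\<close> on \<open>\<B>\<close>, by at least \<open>- k t / m\<close> on the rest of \<open>\<T>\<close> and by at least
  \<open>- k\<close> elsewhere; the overall average of the change is zero.\<close>

theorem competing_maximizer_probability_le:
  fixes r t :: real
  assumes V: "finite V" and C: "finite \<C>" "\<C> \<noteq> {}" "\<And>c. c \<in> \<C> \<Longrightarrow> c \<subseteq> V"
    and m: "k \<le> m" "m > 0" "2 * m \<le> card V" and t: "t \<ge> 0" and r: "r \<ge> 1"
  defines "\<G> \<equiv> subsets_of_card V m"
  assumes typical: "\<And>G c. G \<in> \<T> \<Longrightarrow> c \<in> \<C> \<Longrightarrow>
      real (card (G \<inter> c)) \<le> real m / real (card V) * real (card c) + t"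
    and bad: "\<B> \<subseteq> \<T>" "\<And>G. G \<in> \<G> \<inter> \<B> \<Longrightarrow> \<exists>c\<in>\<C>. \<exists>d\<in>\<C>.
      card (G \<inter> c) = max_meet \<C> G \<and> real (max_meet \<C> G) - (r - 1) \<le> real (card (G \<inter> d)) \<and>
      64 * r^2 \<le> real k * (real (card (G - sym_diff c d)) / real m
                             * (real (card (sym_diff c d - G)) / real (card (V - G))))"
  shows "r / 2 * average \<G> (\<lambda>G. of_bool (G \<in> \<B>))
    \<le> real k * t / real m + real k * average \<G> (\<lambda>G. of_bool (G \<notin> \<T>))"
proof -
  let ?f = "\<lambda>H. real (max_meet \<C> H)" and ?L = "real k * t / real m"
  have ne: "finite \<G>" "\<G> \<noteq> {}"
  proof -
    show "finite \<G>" unfolding \<G>_def by (rule finite_subsets_of_card[OF V])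
    have "card \<G> > 0" unfolding \<G>_def using m by (simp add: card_subsets_of_card[OF V])
    then show "\<G> \<noteq> {}" by auto
  qed
  have L: "?L \<ge> 0" using t by simp
  have pt: "r / 2 * of_bool (G \<in> \<B>) - ?L - real k * of_bool (G \<notin> \<T>) \<le> resample k V ?f G - ?f G"
    if G: "G \<in> \<G>" for G
  proof -
    have GV: "G \<subseteq> V" and cG: "card G = m" using G by (auto simp: \<G>_def subsets_of_card_def)
    have cVG: "card (V - G) = card V - m" using GV V cG by (simp add: card_Diff_subset finite_subset)
    interpret swap_setting V G k
      by unfold_locales (use V GV cG cVG m in auto)
    have dr: "- ?L \<le> drift k V G c" if "c \<in> \<C>" "G \<in> \<T>" for c
      using drift_ge[OF V GV C(3)[OF that(1)] _ _ t, of k] typical[OF that(2,1)] m cG by simp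
    show ?thesis
    proof (cases "G \<in> \<T>")
      case False
      then show ?thesis
        using resample_max_meet_ge_minus[OF C(1,2)] bad(1) L by auto
    next
      case T: True
      show ?thesis
      proof (cases "G \<in> \<B>")
        case False
        have "max_meet \<C> G \<in> (\<lambda>c. card (G \<inter> c)) ` \<C>"
          unfolding max_meet_def using C by (intro Max_in) auto
        then obtain c where c: "c \<in> \<C>" "max_meet \<C> G = card (G \<inter> c)" by auto
        show ?thesis
          using resample_max_meet_ge[OF C(1) c(1) C(3)[OF c(1)]] dr[OF c(1) T] c(2) False T by simp
      next
        case True
        then obtain c d where cd: "c \<in> \<C>" "d \<in> \<C>" and cm: "card (G \<inter> c) = max_meet \<C> G"
          and dm: "real (max_meet \<C> G) - (r - 1) \<le> real (card (G \<inter> d))"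
          and mu: "64 * r^2 \<le> real k * (real (card (G - sym_diff c d)) / real m
                             * (real (card (sym_diff c d - G)) / real (card (V - G))))"
          using bad(2)[of G] G by auto
        define \<mu> where "\<mu> = real k * (real (card (G - sym_diff c d)) / real (card G)
                             * (real (card (sym_diff c d - G)) / real (card (V - G))))"
        have mu': "64 * r^2 \<le> \<mu>" using mu by (simp add: \<mu>_def cG)
        have r2: "1 \<le> r^2" using r by simp
        have \<mu>: "\<mu> \<ge> 64" using mu' r2 by linarith
        have "8 * r = sqrt (64 * r^2)" using r by (simp add: real_sqrt_mult)
        also have "\<dots> \<le> sqrt \<mu>" using mu' by simp
        finally have sq: "8 * r \<le> sqrt \<mu>" .
        have "1 / (2 * \<mu>) \<le> 1 / 128" using \<mu> by (intro divide_left_mono) auto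
        then have "8 * r * (127 / 128) \<le> sqrt \<mu> * (1 - 1 / (2 * \<mu>))"
          using sq r \<mu> by (intro mult_mono) auto
        then have gain: "r \<le> sqrt \<mu> * (1 - 1 / (2 * \<mu>)) / 7" using r by simp
        have "(real (card (G \<inter> c)) + drift k V G c + (real (card (G \<inter> d)) + drift k V G d)) / 2
            + sqrt \<mu> * (1 - 1 / (2 * \<mu>)) / 7 \<le> resample k V ?f G"
          unfolding \<mu>_def
        proof (rule resample_max_meet_ge_two[OF C(1) cd C(3)[OF cd(1)] C(3)[OF cd(2)]])
          have "0 < \<mu>" using \<mu> by simp
          then show "0 < real k * (real (card (G - sym_diff c d)) / real (card G)
                             * (real (card (sym_diff c d - G)) / real (card (V - G))))"
            unfolding \<mu>_def .
        qed
        moreover have "real (card (G \<inter> c)) = ?f G" by (simp only: cm)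
        ultimately have "r / 2 - ?L \<le> resample k V ?f G - ?f G"
          using gain dr[OF cd(1) T] dr[OF cd(2) T] dm by argo
        then show ?thesis using T True by simp
      qed
    qed
  qed
  have "r / 2 * average \<G> (\<lambda>G. of_bool (G \<in> \<B>)) - ?L - real k * average \<G> (\<lambda>G. of_bool (G \<notin> \<T>))
      = average \<G> (\<lambda>G. r / 2 * of_bool (G \<in> \<B>) - ?L - real k * of_bool (G \<notin> \<T>))"
    by (simp only: average_diff average_cmult average_const[OF ne])
  also have "\<dots> \<le> average \<G> (\<lambda>G. resample k V ?f G - ?f G)"
    by (rule average_mono) (rule pt)
  also have "\<dots> = 0"
    unfolding average_diff \<G>_def using average_resample[OF V m(1), of ?f] m by simp
  finally show ?thesis by simp
qed

section \<open>No cut is met by many more edges than expected\<close>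

text \<open>A fixed set of \<open>j\<close> elements lies in a random \<open>m\<close>-subset with probability at most \<open>(m / n)^j\<close>,
  the value for independent elements, as each factor \<open>(m - i) / (n - i)\<close> is at most \<open>m / n\<close>.\<close>

lemma binomial_shift_le:
  assumes "j \<le> m" "m \<le> n"
  shows "real ((n - j) choose (m - j)) \<le> (real m / real n)^j * real (n choose m)"
  using assms(1)
proof (induction j)
  case (Suc j)
  obtain a b where ab: "m - j = Suc a" "n - j = Suc b"
    using Suc.prems assms(2) by (metis Suc_diff_Suc Suc_le_lessD order_less_le_trans)
  have eqs: "n - Suc j = b" "m - Suc j = a" "real (Suc a) = real m - real j" "real (Suc b) = real n - real j"
    using ab Suc.prems assms(2) by linarith+
  have "real (Suc a) * real (Suc b choose Suc a) = real (Suc b) * real (b choose a)"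
    by (metis Suc_times_binomial of_nat_mult)
  then have "real (b choose a) = real (Suc a) / real (Suc b) * real (Suc b choose Suc a)"
    by (simp add: field_simps)
  also have "\<dots> \<le> real m / real n * real (Suc b choose Suc a)"
  proof (intro mult_right_mono)
    have "(real m - real j) * real n \<le> real m * (real n - real j)"
      using assms(2) by (simp add: algebra_simps mult_left_mono)
    moreover have "real n > 0" "real n - real j > 0" using Suc.prems assms(2) by linarith+
    ultimately show "real (Suc a) / real (Suc b) \<le> real m / real n"
      unfolding eqs by (simp add: divide_simps)
  qed simp
  also have "\<dots> \<le> real m / real n * ((real m / real n)^j * real (n choose m))"
    using Suc unfolding ab by (intro mult_left_mono) auto
  finally show ?case by (simp only: eqs power_Suc mult.assoc)
qed simp

lemma card_superset_le:
  assumes V: "finite V" and T: "T \<subseteq> V" and m: "m \<le> card V"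
  shows "real (card {G \<in> subsets_of_card V m. T \<subseteq> G})
    \<le> (real m / real (card V))^card T * real (card (subsets_of_card V m))"
proof (cases "card T \<le> m")
  case True
  have fT: "finite T" using T V finite_subset by blast
  have "card {G \<in> subsets_of_card V m. T \<subseteq> G} = card {H. H \<subseteq> V - T \<and> card H = m - card T}"
  proof (rule bij_betw_same_card[of "\<lambda>G. G - T"], rule bij_betw_byWitness[of _ "\<lambda>H. H \<union> T"])
    show "\<forall>G\<in>{G \<in> subsets_of_card V m. T \<subseteq> G}. (G - T) \<union> T = G" by auto
    show "\<forall>H\<in>{H. H \<subseteq> V - T \<and> card H = m - card T}. (H \<union> T) - T = H" by auto
    show "(\<lambda>G. G - T) ` {G \<in> subsets_of_card V m. T \<subseteq> G} \<subseteq> {H. H \<subseteq> V - T \<and> card H = m - card T}"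
      using fT by (auto simp: subsets_of_card_def card_Diff_subset)
    show "(\<lambda>H. H \<union> T) ` {H. H \<subseteq> V - T \<and> card H = m - card T} \<subseteq> {G \<in> subsets_of_card V m. T \<subseteq> G}"
    proof (rule image_subsetI)
      fix H assume H: "H \<in> {H. H \<subseteq> V - T \<and> card H = m - card T}"
      then have "finite H" "H \<inter> T = {}" using V finite_subset by auto
      then have "card (H \<union> T) = m" using H fT True by (simp add: card_Un_disjoint)
      then show "H \<union> T \<in> {G \<in> subsets_of_card V m. T \<subseteq> G}"
        using H T by (auto simp: subsets_of_card_def)
    qed
  qed
  also have "\<dots> = (card V - card T) choose (m - card T)"
    using n_subsets[of "V - T" "m - card T"] V T fT by (simp add: card_Diff_subset)
  finally show ?thesis
    using binomial_shift_le[OF True m] by (simp add: card_subsets_of_card[OF V])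
next
  case False
  have none: "{G \<in> subsets_of_card V m. T \<subseteq> G} = {}"
  proof -
    have "card T \<le> card G" if "G \<subseteq> V" "T \<subseteq> G" for G
      using that V finite_subset card_mono by blast
    then show ?thesis using False by (auto simp: subsets_of_card_def)
  qed
  show ?thesis unfolding none by simp
qed

lemma sum_power_card_Pow:
  assumes "finite A"
  shows "(\<Sum>T\<in>Pow A. w ^ card T) = (1 + w :: real) ^ card A"
  using assms
proof induction
  case (insert x A)
  have "w ^ card T + w ^ card (insert x T) = (1 + w) * w ^ card T" if "T \<in> Pow A" for T
  proof -
    have "finite T" "x \<notin> T" using that insert finite_subset by auto
    then show ?thesis by (simp add: algebra_simps)
  qed
  then have "(\<Sum>T\<in>Pow (insert x A). w ^ card T) = (1 + w) * (\<Sum>T\<in>Pow A. w ^ card T)"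
    by (simp only: sum_Pow_insert[OF insert(1,2)] sum_distrib_left cong: sum.cong)
  then show ?case using insert by simp
qed simp

text \<open>The generating function of the hypergeometric distribution lies below that of the binomial one:
  expand \<open>(1 + w)^card (G \<inter> c)\<close> over the subsets of \<open>G \<inter> c\<close> and bound the probability that \<open>G\<close>
  contains a given subset of \<open>c\<close>.\<close>

lemma average_power_card_Int_le:
  assumes V: "finite V" and c: "c \<subseteq> V" and m: "m \<le> card V" and w: "w \<ge> 0"
  shows "average (subsets_of_card V m) (\<lambda>G. (1 + w) ^ card (G \<inter> c))
    \<le> exp (w * (real m / real (card V)) * real (card c))"
proof -
  let ?\<G> = "subsets_of_card V m" and ?p = "real m / real (card V)"
  have fc: "finite c" using c V finite_subset by blast
  have fG: "finite ?\<G>" by (rule finite_subsets_of_card[OF V])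
  have pos: "card ?\<G> > 0" using m by (simp add: card_subsets_of_card[OF V])
  have "(\<Sum>G\<in>?\<G>. (1 + w) ^ card (G \<inter> c)) = (\<Sum>G\<in>?\<G>. \<Sum>T\<in>Pow c. w ^ card T * of_bool (T \<subseteq> G))"
  proof (rule sum.cong[OF refl])
    fix G
    have "(1 + w) ^ card (G \<inter> c) = (\<Sum>T\<in>Pow (G \<inter> c). w ^ card T)"
      by (rule sum_power_card_Pow[symmetric]) (use fc in simp)
    also have "\<dots> = (\<Sum>T\<in>Pow c. w ^ card T * of_bool (T \<subseteq> G))"
      by (rule sum.mono_neutral_cong_left) (use fc in auto)
    finally show "(1 + w) ^ card (G \<inter> c) = (\<Sum>T\<in>Pow c. w ^ card T * of_bool (T \<subseteq> G))" .
  qed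
  also have "\<dots> = (\<Sum>T\<in>Pow c. w ^ card T * real (card {G \<in> ?\<G>. T \<subseteq> G}))"
    by (subst sum.swap) (use fG in \<open>simp add: sum_distrib_left[symmetric] Collect_conj_eq Int_commute\<close>)
  also have "\<dots> \<le> (\<Sum>T\<in>Pow c. w ^ card T * (?p ^ card T * real (card ?\<G>)))"
    using w c by (intro sum_mono mult_left_mono card_superset_le[OF V _ m]) auto
  also have "\<dots> = real (card ?\<G>) * (\<Sum>T\<in>Pow c. (w * ?p) ^ card T)"
    by (simp only: sum_distrib_left power_mult_distrib mult_ac)
  also have "\<dots> = real (card ?\<G>) * (1 + w * ?p) ^ card c"
    by (simp only: sum_power_card_Pow[OF fc])
  also have "\<dots> \<le> real (card ?\<G>) * exp (w * ?p) ^ card c"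
    using w by (intro mult_left_mono power_mono) (auto simp: exp_ge_add_one_self)
  also have "exp (w * ?p) ^ card c = exp (w * ?p * real (card c))"
    by (simp only: exp_of_nat2_mult)
  finally show ?thesis using pos by (simp add: average_def pos_divide_le_eq mult.commute)
qed

text \<open>Markov's inequality for the exponential of \<open>l * card (G \<inter> c)\<close>, with \<open>exp l \<le> 1 + l + l\<^sup>2\<close>.\<close>

lemma card_Int_tail_bound:
  assumes V: "finite V" and c: "c \<subseteq> V" and m: "m \<le> card V" and l: "0 \<le> l" "l \<le> 1"
  defines "p \<equiv> real m / real (card V)"
  shows "average (subsets_of_card V m) (\<lambda>G. of_bool (real (card (G \<inter> c)) > p * real (card c) + t))
    \<le> exp (l^2 * p * real (card c) - l * t)"
proof -
  let ?\<G> = "subsets_of_card V m" and ?c = "real (card c)"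
  have p: "p \<ge> 0" by (simp add: p_def)
  have "exp (l * (p * ?c + t)) * average ?\<G> (\<lambda>G. of_bool (real (card (G \<inter> c)) > p * ?c + t))
      \<le> average ?\<G> (\<lambda>G. (1 + (exp l - 1)) ^ card (G \<inter> c))"
    unfolding average_cmult[symmetric]
  proof (rule average_mono)
    fix G
    have "exp (l * (p * ?c + t)) \<le> exp (l * real (card (G \<inter> c)))" if "real (card (G \<inter> c)) > p * ?c + t"
      using l that by (simp add: mult_left_mono)
    then show "exp (l * (p * ?c + t)) * of_bool (real (card (G \<inter> c)) > p * ?c + t) \<le> (1 + (exp l - 1)) ^ card (G \<inter> c)"
      by (auto simp: exp_of_nat2_mult[symmetric])
  qed
  also have "\<dots> \<le> exp ((exp l - 1) * p * ?c)"
    unfolding p_def by (rule average_power_card_Int_le[OF V c m]) (use l in simp)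
  also have "\<dots> \<le> exp ((l + l^2) * p * ?c)"
    using exp_bound[OF l] p by (simp add: mult_right_mono)
  finally have "average ?\<G> (\<lambda>G. of_bool (real (card (G \<inter> c)) > p * ?c + t))
      \<le> exp ((l + l^2) * p * ?c) / exp (l * (p * ?c + t))"
    by (simp add: pos_le_divide_eq mult.commute)
  also have "\<dots> = exp (l^2 * p * ?c - l * t)"
    by (simp add: exp_diff[symmetric] algebra_simps)
  finally show ?thesis .
qed

lemma union_tail_bound:
  assumes V: "finite V" and C: "finite \<C>" "\<And>c. c \<in> \<C> \<Longrightarrow> c \<subseteq> V" "\<And>c. c \<in> \<C> \<Longrightarrow> real (card c) \<le> A"
    and m: "m \<le> card V" and l: "0 \<le> l" "l \<le> 1"
  defines "p \<equiv> real m / real (card V)"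
  shows "average (subsets_of_card V m) (\<lambda>G. of_bool (\<exists>c\<in>\<C>. real (card (G \<inter> c)) > p * real (card c) + t))
    \<le> real (card \<C>) * exp (l^2 * p * A - l * t)"
proof -
  let ?\<G> = "subsets_of_card V m"
  have "average ?\<G> (\<lambda>G. of_bool (\<exists>c\<in>\<C>. real (card (G \<inter> c)) > p * real (card c) + t))
      \<le> average ?\<G> (\<lambda>G. \<Sum>c\<in>\<C>. of_bool (real (card (G \<inter> c)) > p * real (card c) + t))"
  proof (rule average_mono)
    fix G
    show "of_bool (\<exists>c\<in>\<C>. real (card (G \<inter> c)) > p * real (card c) + t)
        \<le> (\<Sum>c\<in>\<C>. of_bool (real (card (G \<inter> c)) > p * real (card c) + t) :: real)"
    proof (cases "\<exists>c\<in>\<C>. real (card (G \<inter> c)) > p * real (card c) + t")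
      case True
      then obtain c where c: "c \<in> \<C>" "real (card (G \<inter> c)) > p * real (card c) + t" by blast
      then show ?thesis
        using member_le_sum[OF c(1), of "\<lambda>c. of_bool (real (card (G \<inter> c)) > p * real (card c) + t) :: real"] C(1)
        by auto
    next
      case False
      then show ?thesis by (simp add: sum_nonneg)
    qed
  qed
  also have "\<dots> = (\<Sum>c\<in>\<C>. average ?\<G> (\<lambda>G. of_bool (real (card (G \<inter> c)) > p * real (card c) + t)))"
    by (rule average_sum)
  also have "\<dots> \<le> (\<Sum>c\<in>\<C>. exp (l^2 * p * A - l * t))"
  proof (rule sum_mono)
    fix c assume c: "c \<in> \<C>"
    have "l^2 * p * real (card c) \<le> l^2 * p * A"
      using C(3)[OF c] by (intro mult_left_mono) (auto simp: p_def)
    then show "average ?\<G> (\<lambda>G. of_bool (real (card (G \<inter> c)) > p * real (card c) + t)) \<le> exp (l^2 * p * A - l * t)"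
      using card_Int_tail_bound[OF V C(2)[OF c] m l, of t] unfolding p_def
      by (elim order_trans) simp
  qed
  finally show ?thesis by simp
qed

section \<open>Bipartitions of the vertex set\<close>

text \<open>The cut of a bipartition is represented by its crossing edges in the complete graph, so that the
  cut size in \<open>G\<close> is the size of an intersection with \<open>G\<close>.\<close>

definition cut_sets :: "nat \<Rightarrow> nat set set set" where
  "cut_sets n = crossing_edges (nsets {1..n} 2) ` bipartitions n"

lemma bipartitionsD:
  assumes "P \<in> bipartitions n"
  shows "fst P \<union> snd P = {1..n}" "fst P \<inter> snd P = {}" "snd P = {1..n} - fst P"
    "finite (fst P)" "finite (snd P)" "card (fst P) + card (snd P) = n"
proof -
  show 1: "fst P \<union> snd P = {1..n}" and 2: "fst P \<inter> snd P = {}"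
    using assms by (auto simp: bipartitions_def)
  show "snd P = {1..n} - fst P" using 1 2 by blast
  show f: "finite (fst P)" "finite (snd P)" using 1 by (metis finite_Un finite_atLeastAtMost)+
  show "card (fst P) + card (snd P) = n"
    using card_Un_disjoint[OF f 2] 1 by simp
qed

lemma bipartitions_subset: "bipartitions n \<subseteq> (\<lambda>A. (A, {1..n} - A)) ` Pow {1..n}"
proof
  fix P assume P: "P \<in> bipartitions n"
  have "P = (fst P, {1..n} - fst P)" using bipartitionsD(3)[OF P] by (metis prod.collapse)
  moreover have "fst P \<in> Pow {1..n}" using bipartitionsD(1)[OF P] by blast
  ultimately show "P \<in> (\<lambda>A. (A, {1..n} - A)) ` Pow {1..n}" by blast
qed

lemma finite_bipartitions: "finite (bipartitions n)"
  using bipartitions_subset by (rule finite_subset) simp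

lemma card_cut_sets_le: "finite (cut_sets n)" "card (cut_sets n) \<le> 2 ^ n"
proof -
  show "finite (cut_sets n)" by (simp add: cut_sets_def finite_bipartitions)
  have "card (cut_sets n) \<le> card (bipartitions n)"
    unfolding cut_sets_def by (rule card_image_le[OF finite_bipartitions])
  also have "\<dots> \<le> card ((\<lambda>A. (A, {1..n} - A)) ` Pow {1..n})"
    by (rule card_mono[OF _ bipartitions_subset]) simp
  also have "\<dots> \<le> card (Pow {1..n})" by (rule card_image_le) simp
  finally show "card (cut_sets n) \<le> 2 ^ n" by (simp add: card_Pow)
qed

lemma cut_sets_nonempty: "cut_sets n \<noteq> {}"
proof -
  have "({}, {1..n}) \<in> bipartitions n" by (simp add: bipartitions_def)
  then show ?thesis by (auto simp: cut_sets_def)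
qed

lemma cut_sets_subset: "c \<in> cut_sets n \<Longrightarrow> c \<subseteq> nsets {1..n} 2"
  by (auto simp: cut_sets_def crossing_edges_def)

lemma crossing_edges_eq_Int:
  "G \<subseteq> nsets {1..n} 2 \<Longrightarrow> crossing_edges G P = G \<inter> crossing_edges (nsets {1..n} 2) P"
  by (auto simp: crossing_edges_def)

lemma max_cut_eq_max_meet:
  "G \<subseteq> nsets {1..n} 2 \<Longrightarrow> max_cut n G = max_meet (cut_sets n) G"
  by (simp add: max_cut_def max_meet_def cut_sets_def image_image crossing_edges_eq_Int)

lemma card_crossing_edges:
  assumes "P \<in> bipartitions n"
  shows "card (crossing_edges (nsets {1..n} 2) P) = card (fst P) * card (snd P)"
proof -
  note P = bipartitionsD[OF assms]
  have "crossing_edges (nsets {1..n} 2) P = (\<lambda>(a, b). {a, b}) ` (fst P \<times> snd P)"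
  proof
    show "crossing_edges (nsets {1..n} 2) P \<subseteq> (\<lambda>(a, b). {a, b}) ` (fst P \<times> snd P)"
      by (auto simp: crossing_edges_def)
    show "(\<lambda>(a, b). {a, b}) ` (fst P \<times> snd P) \<subseteq> crossing_edges (nsets {1..n} 2) P"
    proof (clarify)
      fix a b assume ab: "a \<in> fst P" "b \<in> snd P"
      then have "{a, b} \<subseteq> {1..n}" "a \<noteq> b" using P(1,2) by blast+
      then have "{a, b} \<in> nsets {1..n} 2" by (simp add: nsets_def)
      then show "{a, b} \<in> crossing_edges (nsets {1..n} 2) P"
        using ab by (auto simp: crossing_edges_def)
    qed
  qed
  moreover have "inj_on (\<lambda>(a, b). {a, b}) (fst P \<times> snd P)"
    using P(2) by (auto simp: inj_on_def doubleton_eq_iff)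
  ultimately show ?thesis by (simp add: card_image card_cartesian_product)
qed

lemma card_cut_le:
  assumes "c \<in> cut_sets n"
  shows "real (card c) \<le> real n ^ 2 / 4"
proof -
  obtain P where P: "P \<in> bipartitions n" "c = crossing_edges (nsets {1..n} 2) P"
    using assms by (auto simp: cut_sets_def)
  let ?a = "real (card (fst P))" and ?b = "real (card (snd P))"
  have n: "real n = ?a + ?b" using bipartitionsD(6)[OF P(1)] by linarith
  have "0 \<le> (?a - ?b)^2" by simp
  then have "?a * ?b \<le> real n ^ 2 / 4" unfolding n by (simp add: power2_eq_square algebra_simps)
  then show ?thesis unfolding P(2) card_crossing_edges[OF P(1)] by simp
qed

lemma doubleton_in_crossing_edges:
  assumes P: "P \<in> bipartitions n" and xy: "x \<in> {1..n}" "y \<in> {1..n}" "x \<noteq> y"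
  shows "{x, y} \<in> crossing_edges (nsets {1..n} 2) P \<longleftrightarrow> (x \<in> fst P) \<noteq> (y \<in> fst P)"
proof -
  have "{x, y} \<in> nsets {1..n} 2" using xy by (simp add: nsets_def)
  moreover have "(\<exists>a\<in>fst P. \<exists>b\<in>{1..n} - fst P. {x, y} = {a, b}) \<longleftrightarrow> (x \<in> fst P) \<noteq> (y \<in> fst P)"
    unfolding doubleton_eq_iff using xy by blast
  ultimately show ?thesis
    unfolding crossing_edges_def bipartitionsD(3)[OF P] by blast
qed

text \<open>The first part collects the vertices on which \<open>P\<close> and \<open>Q\<close> agree, the second part those on which
  they disagree. A pair crosses exactly one of \<open>P\<close> and \<open>Q\<close> if and only if it crosses this
  bipartition, and the distance of \<open>P\<close> and \<open>Q\<close> is the size of its smaller part.\<close>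

definition merge_bip :: "nat set \<times> nat set \<Rightarrow> nat set \<times> nat set \<Rightarrow> nat set \<times> nat set" where
  "merge_bip P Q = ((fst Q \<inter> fst P) \<union> (snd Q \<inter> snd P), (fst Q \<inter> snd P) \<union> (snd Q \<inter> fst P))"

lemma merge_bip_mem:
  assumes P: "P \<in> bipartitions n" and Q: "Q \<in> bipartitions n"
  shows "merge_bip P Q \<in> bipartitions n"
  using bipartitionsD(1,2)[OF P] bipartitionsD(1,2)[OF Q]
  unfolding merge_bip_def bipartitions_def by blast

lemma sym_diff_crossing_edges:
  assumes P: "P \<in> bipartitions n" and Q: "Q \<in> bipartitions n"
  shows "sym_diff (crossing_edges (nsets {1..n} 2) P) (crossing_edges (nsets {1..n} 2) Q)
    = crossing_edges (nsets {1..n} 2) (merge_bip P Q)" (is "?l = ?r")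
proof (rule set_eqI)
  fix e
  show "e \<in> ?l \<longleftrightarrow> e \<in> ?r"
  proof (cases "e \<in> nsets {1..n} 2")
    case True
    then obtain x y where xy: "e = {x, y}" "x \<in> {1..n}" "y \<in> {1..n}" "x \<noteq> y"
      by (auto simp: nsets_def card_2_iff)
    have m: "z \<in> fst (merge_bip P Q) \<longleftrightarrow> (z \<in> fst P) = (z \<in> fst Q)" if "z \<in> {1..n}" for z
      using that unfolding merge_bip_def bipartitionsD(3)[OF P] bipartitionsD(3)[OF Q] by auto
    show ?thesis
      using doubleton_in_crossing_edges[OF P xy(2-4)] doubleton_in_crossing_edges[OF Q xy(2-4)]
        doubleton_in_crossing_edges[OF merge_bip_mem[OF P Q] xy(2-4)] m[OF xy(2)] m[OF xy(3)]
      unfolding xy(1) by blast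
  qed (auto simp: crossing_edges_def)
qed

lemma dist_bip_eq:
  assumes P: "P \<in> bipartitions n" and Q: "Q \<in> bipartitions n"
  shows "dist_bip P Q = min (card (fst (merge_bip P Q))) (card (snd (merge_bip P Q)))"
proof -
  note f = bipartitionsD(4,5)[OF P] bipartitionsD(4,5)[OF Q]
  have "card (fst (merge_bip P Q)) = card (fst Q \<inter> fst P) + card (snd Q \<inter> snd P)"
    unfolding merge_bip_def fst_conv
    by (rule card_Un_disjoint) (use f bipartitionsD(2)[OF P] in auto)
  moreover have "card (snd (merge_bip P Q)) = card (fst Q \<inter> snd P) + card (snd Q \<inter> fst P)"
    unfolding merge_bip_def snd_conv
    by (rule card_Un_disjoint) (use f bipartitionsD(2)[OF P] in auto)
  ultimately show ?thesis by (simp add: dist_bip_def split_beta)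
qed

lemma dist_bip_le_half:
  assumes P: "P \<in> bipartitions n" and Q: "Q \<in> bipartitions n"
  shows "real (dist_bip P Q) \<le> real n / 2"
  using dist_bip_eq[OF P Q] bipartitionsD(6)[OF merge_bip_mem[OF P Q]] by linarith

text \<open>The larger part of the merged bipartition has at least \<open>n / 2\<close> vertices.\<close>

lemma card_sym_diff_ge:
  assumes P: "P \<in> bipartitions n" and Q: "Q \<in> bipartitions n"
  shows "real (dist_bip P Q) * real n / 2
    \<le> real (card (sym_diff (crossing_edges (nsets {1..n} 2) P) (crossing_edges (nsets {1..n} 2) Q)))"
proof -
  let ?u = "real (card (fst (merge_bip P Q)))" and ?v = "real (card (snd (merge_bip P Q)))"
  have n: "real n = ?u + ?v" using bipartitionsD(6)[OF merge_bip_mem[OF P Q]] by linarith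
  have d: "real (dist_bip P Q) \<le> ?u" "real (dist_bip P Q) \<le> ?v" using dist_bip_eq[OF P Q] by simp_all
  have "real (dist_bip P Q) * real n / 2 \<le> ?u * ?v"
  proof (cases "?u \<le> ?v")
    case True
    have "real (dist_bip P Q) * (real n / 2) \<le> ?u * ?v"
      using d(1) True n by (intro mult_mono) auto
    then show ?thesis by simp
  next
    case False
    have "real (dist_bip P Q) * (real n / 2) \<le> ?v * ?u"
      using d(2) False n by (intro mult_mono) auto
    then show ?thesis by (simp add: mult.commute)
  qed
  then show ?thesis
    unfolding sym_diff_crossing_edges[OF P Q] card_crossing_edges[OF merge_bip_mem[OF P Q]] by simp
qed

lemma optimal_opt_bipartition:
  assumes "set L = bipartitions n"
  shows "optimal n G (opt_bipartition L n G)"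
proof -
  have "max_cut n G \<in> (\<lambda>P. card (crossing_edges G P)) ` bipartitions n"
    unfolding max_cut_def using finite_bipartitions cut_sets_nonempty
    by (intro Max_in) (auto simp: cut_sets_def)
  then obtain P where "P \<in> bipartitions n" "optimal n G P" by (auto simp: optimal_def)
  then have "P \<in> set (filter (optimal n G) L)" using assms unfolding set_filter by blast
  then have "filter (optimal n G) L \<noteq> []" by (metis list.set(1) empty_iff)
  then have "hd (filter (optimal n G) L) \<in> set (filter (optimal n G) L)" by (rule hd_in_set)
  then show ?thesis by (simp add: opt_bipartition_def)
qed

section \<open>Near-optimal bipartitions far from the canonical one\<close>

lemma real_choose_two: "real (n choose 2) = real n * (real n - 1) / 2"
proof (cases n)
  case (Suc m)
  then show ?thesis by (simp add: choose_two real_of_nat_div algebra_simps)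
qed simp

text \<open>The probability that a swap is a hit, for \<open>X\<close> the symmetric difference of two cuts at distance
  \<open>s\<close> in a typical graph. As \<open>X\<close> is itself a cut, it contains at most about \<open>p n\<^sup>2 / 4 \<approx> M / 2\<close> edges, which leaves a random edge outside \<open>X\<close> with
  probability at least 1/4. On the other hand at least about half of the pairs in \<open>X\<close>, and hence a
  number of order \<open>s n\<close> of them, are non-edges. Both estimates absorb the error term \<open>2 n q\<close>
  because \<open>q\<close> and \<open>s / q\<close> are large.\<close>

lemma symdiff_weight_ge:
  fixes n M :: nat and p q s :: real
  assumes GX: "X \<subseteq> nsets {1..n} 2" "G \<subseteq> nsets {1..n} 2" "card G = M"
    and M: "real M = p * real (n choose 2)" and p: "0 < p" "p \<le> 1 / 2"
    and q: "q \<ge> 32" "q ^ 2 = p * real n" and n: "n \<ge> 6"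
    and X: "s * real n / 2 \<le> real (card X)" "real (card X) \<le> real n ^ 2 / 4"
    and x: "real (card (G \<inter> X)) \<le> p * real (card X) + 2 * real n * q"
    and s: "16 * q \<le> s"
  shows "s / (16 * real n) \<le> real (card (G - X)) / real M
      * (real (card (X - G)) / real (card (nsets {1..n} 2 - G)))"
proof -
  let ?V = "nsets {1..n} 2" and ?n = "real n"
  have fV: "finite ?V" by (rule finite_imp_finite_nsets) simp
  have fin: "finite X" "finite G" using GX fV finite_subset by auto
  have N: "real (card ?V) = ?n * (?n - 1) / 2" using real_choose_two by (simp add: card_nsets)
  have Meq: "real M = q^2 * (?n - 1) / 2" by (simp add: M real_choose_two q)
  have n0: "?n > 0" "?n - 1 > 0" using n by auto
  have q0: "q > 0" using q(1) by simp
  have Mpos: "real M > 0" unfolding Meq using q0 n0 by simp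
  have "card (G - X) = card G - card (G \<inter> X)" "card (G \<inter> X) \<le> card G"
    "card (X - G) = card X - card (G \<inter> X)" "card (G \<inter> X) \<le> card X"
    using fin by (auto simp: card_Diff_subset_Int Int_commute intro: card_mono)
  then have c: "real (card (G - X)) = real M - real (card (G \<inter> X))"
    "real (card (X - G)) = real (card X) - real (card (G \<inter> X))" using GX by auto
  have a: "1 / 4 \<le> real (card (G - X)) / real M"
  proof -
    have "p * real (card X) \<le> p * (?n^2 / 4)" using X(2) p by (intro mult_left_mono) auto
    also have "\<dots> = q^2 * ?n / 4" unfolding q(2) by (simp add: power2_eq_square)
    finally have 1: "real (card (G \<inter> X)) \<le> q^2 * ?n / 4 + 2 * ?n * q" using x by linarith
    have "32 * (?n * q) \<le> q * (?n * q)" using q n0 by (intro mult_right_mono) auto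
    then have 2: "2 * ?n * q \<le> q^2 * ?n / 16" by (simp add: power2_eq_square algebra_simps)
    have "q^2 * 6 \<le> q^2 * ?n" using n by (intro mult_left_mono) auto
    then have "q^2 * ?n / 4 + q^2 * ?n / 16 \<le> 3 / 4 * (q^2 * (?n - 1) / 2)"
      by (simp add: algebra_simps)
    then have "real (card (G \<inter> X)) \<le> 3 / 4 * real M" using 1 2 Meq by linarith
    then have "1 / 4 * real M \<le> real (card (G - X))" unfolding c by linarith
    then show ?thesis using Mpos by (simp add: pos_le_divide_eq)
  qed
  have b: "s / (4 * ?n) \<le> real (card (X - G)) / real (card (?V - G))"
  proof -
    have "p * real (card X) \<le> 1 / 2 * real (card X)" using p by (intro mult_right_mono) auto
    moreover have "2 * ?n * q \<le> s * ?n / 8"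
      using mult_right_mono[OF s, of ?n] n0 by (simp add: mult_ac)
    ultimately have 1: "s * ?n / 8 \<le> real (card (X - G))"
      unfolding c using x X(1) by linarith
    have "card (?V - G) \<le> card ?V" using fV by (intro card_mono) auto
    then have 2: "real (card (?V - G)) \<le> ?n^2 / 2" using N by (simp add: power2_eq_square algebra_simps)
    have "card (?V - G) = card ?V - M" using GX fin by (simp add: card_Diff_subset)
    moreover have "real M < real (card ?V)"
    proof -
      have "p * real (n choose 2) < 1 * real (n choose 2)"
        using p n by (intro mult_strict_right_mono) auto
      then show ?thesis by (simp add: M card_nsets)
    qed
    ultimately have 3: "real (card (?V - G)) > 0" by simp
    have "s / (4 * ?n) = (s * ?n / 8) / (?n^2 / 2)" using n0 by (simp add: power2_eq_square)
    also have "\<dots> \<le> real (card (X - G)) / real (card (?V - G))"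
      using 1 2 3 s q n0 by (intro frac_le) auto
    finally show ?thesis .
  qed
  have "s / (16 * ?n) = 1 / 4 * (s / (4 * ?n))" by simp
  also have "\<dots> \<le> real (card (G - X)) / real M * (real (card (X - G)) / real (card (?V - G)))"
    using a b s q n0 by (intro mult_mono) auto
  finally show ?thesis .
qed

lemma prob_random_graph:
  assumes "M \<le> n choose 2"
  shows "measure_pmf.prob (random_graph n M) A
    = average (subsets_of_card (nsets {1..n} 2) M) (\<lambda>G. of_bool (G \<in> A))"
proof -
  let ?\<G> = "subsets_of_card (nsets {1..n} 2) M"
  have fV: "finite (nsets {1..n} 2 :: nat set set)" by (rule finite_imp_finite_nsets) simp
  have fin: "finite ?\<G>" by (rule finite_subsets_of_card[OF fV])
  have "card ?\<G> > 0" unfolding card_subsets_of_card[OF fV] using assms by simp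
  then have ne: "?\<G> \<noteq> {}" by auto
  have "random_graph n M = pmf_of_set ?\<G>"
    by (simp add: random_graph_def graphs_with_edges_def subsets_of_card_def)
  moreover have "(\<Sum>G\<in>?\<G>. of_bool (G \<in> A)) = real (card (?\<G> \<inter> A))"
    by (simp only: sum_of_bool_eq[OF fin fin] Collect_mem_eq)
  ultimately show ?thesis
    by (simp only: average_def measure_pmf_of_set[OF ne fin])
qed

text \<open>The parameters are \<open>q\<^sup>2 = p n\<close>, the deviation \<open>t = 2 n q\<close> allowed to typical graphs, and the number
  \<open>k\<close> of swaps, chosen so that at least \<open>64 r\<^sup>2\<close> hits are expected when the hit probability is at
  least \<open>s\<^sub>0 / (16 n)\<close>.\<close>

lemma prob_far_near_optimal_le:
  fixes n M r :: nat and p \<omega> :: real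
  assumes L: "set L = bipartitions n"
    and M: "real M = p * real (n choose 2)" and p: "0 < p" "p \<le> 1 / 2" and pn: "1024 \<le> p * real n"
    and r: "r \<ge> 1" and \<omega>: "\<omega> \<ge> 1"
  shows "measure_pmf.prob (random_graph n M)
      {G. \<exists>P\<in>bipartitions n. gap n G P = r - 1 \<and>
         real (dist_to_opt L n G P) \<ge> 100000 * \<omega> * real r ^ 4 * sqrt (real n * inverse p)}
    \<le> inverse \<omega>"
proof -
  let ?V = "nsets {1..n} 2 :: nat set set" and ?C = "cut_sets n" and ?n = "real n" and ?r = "real r"
  define s\<^sub>0 where "s\<^sub>0 = 100000 * \<omega> * ?r ^ 4 * sqrt (?n * inverse p)"
  define \<E> where "\<E> = {G. \<exists>P\<in>bipartitions n. gap n G P = r - 1 \<and> s\<^sub>0 \<le> real (dist_to_opt L n G P)}"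
  define q where "q = sqrt (p * ?n)"
  define N where "N = n choose 2"
  define \<G> where "\<G> = subsets_of_card ?V M"
  have n: "?n \<ge> 2048"
    using pn p mult_right_mono[OF p(2), of ?n] by simp
  have q2: "q^2 = p * ?n" using pn by (simp add: q_def)
  have q32: "q \<ge> 32"
    using real_sqrt_le_mono[OF pn] by (simp add: q_def)
  have q0: "q > 0" using q32 by simp
  have qn: "q^2 \<le> ?n / 2"
    unfolding q2 using mult_right_mono[OF p(2), of ?n] by simp
  have fV: "finite ?V" by (rule finite_imp_finite_nsets) simp
  have cV: "card ?V = N" by (simp add: card_nsets N_def)
  have N: "real N = ?n * (?n - 1) / 2" unfolding N_def by (rule real_choose_two)
  have Npos: "real N > 0" unfolding N using n by simp
  have M': "real M = q^2 * (?n - 1) / 2" using M N q2 by (simp add: N_def)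
  have Mpos: "real M > 0" unfolding M' using q0 n by simp
  have MN: "2 * M \<le> N"
  proof -
    have "real M \<le> 1 / 2 * real N" unfolding M N_def using p by (intro mult_right_mono) auto
    then show ?thesis by linarith
  qed
  have pMN: "real M / real (card ?V) = p" using M Npos by (simp add: cV N_def)
  have s0_eq: "s\<^sub>0 = 100000 * \<omega> * ?r ^ 4 * (?n / q)"
  proof -
    have "?n * inverse p = (?n / q)^2" using p n unfolding power_divide q2
      by (simp add: field_simps power2_eq_square)
    then show ?thesis using q0 by (simp add: s\<^sub>0_def)
  qed
  have r1: "1 \<le> ?r" using r by simp
  have r41: "1 \<le> ?r ^ 4" using r1 by simp
  have \<omega>r: "1 \<le> \<omega> * ?r ^ 4" using mult_mono[OF \<omega> r41] \<omega> by simp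
  have s0_ge: "100000 * (?n / q) \<le> s\<^sub>0"
    unfolding s0_eq using mult_right_mono[OF \<omega>r, of "100000 * (?n / q)"] q0 n by (simp add: mult_ac)
  have s0_pos: "s\<^sub>0 > 0" using s0_ge q0 n by (smt (verit) divide_pos_pos)
  have prob: "measure_pmf.prob (random_graph n M) \<E> = average \<G> (\<lambda>G. of_bool (G \<in> \<E>))"
    unfolding \<G>_def by (rule prob_random_graph) (use MN N_def in linarith)
  have "average \<G> (\<lambda>G. of_bool (G \<in> \<E>)) \<le> inverse \<omega>"
  proof (cases "s\<^sub>0 \<le> ?n / 2")
    \<comment> \<open>Two bipartitions are at distance at most \<open>n / 2\<close>, so the event is empty.\<close>
    case False
    have "G \<notin> \<E>" for G
    proof
      assume "G \<in> \<E>"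
      then obtain P where P: "P \<in> bipartitions n" "s\<^sub>0 \<le> real (dist_bip P (opt_bipartition L n G))"
        by (auto simp: \<E>_def dist_to_opt_def)
      have "opt_bipartition L n G \<in> bipartitions n"
        using optimal_opt_bipartition[OF L] by (simp add: optimal_def)
      from dist_bip_le_half[OF P(1) this] P(2) False show False by linarith
    qed
    then show ?thesis using \<omega> by (simp add: average_def)
  next
    case True
    have small: "200000 * \<omega> * ?r ^ 4 \<le> q"
    proof -
      have "100000 * \<omega> * ?r ^ 4 * ?n \<le> ?n / 2 * q"
        using True q0 unfolding s0_eq by (simp add: field_simps)
      then show ?thesis using n by simp
    qed
    define y where "y = 1024 * ?r ^ 2 * ?n / s\<^sub>0"
    define k where "k = nat \<lceil>y\<rceil>"
    define t where "t = 2 * ?n * q"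
    have y1: "1 \<le> y"
    proof -
      have "s\<^sub>0 \<le> 1024 * ?r^2 * ?n"
      proof -
        have "1 * ?n \<le> ?r^2 * ?n" using r1 by (intro mult_right_mono) auto
        then show ?thesis using True n by linarith
      qed
      then show ?thesis using s0_pos by (simp add: y_def pos_le_divide_eq)
    qed
    have ky: "y \<le> real k" "real k \<le> 2 * y"
      unfolding k_def using y1 by linarith+
    have y_le: "100000 * \<omega> * ?r ^ 2 * y = 1024 * q"
      unfolding y_def s0_eq using q0 n \<omega> r1 by (simp add: field_simps power2_eq_square power4_eq_xxxx)
    have kq: "100000 * \<omega> * ?r ^ 2 * real k \<le> 2048 * q"
    proof -
      have "100000 * \<omega> * ?r ^ 2 * real k \<le> 100000 * \<omega> * ?r ^ 2 * (2 * y)"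
        using ky(2) \<omega> by (intro mult_left_mono) auto
      then show ?thesis using y_le by simp
    qed
    \<comment> \<open>In particular \<open>k \<omega> / q\<close> is at most 2048 / 100000, which makes the loss \<open>8 k / q\<close> caused by
      the drift less than \<open>1 / (5 \<omega>)\<close>.\<close>
    have k\<omega>: "100000 * \<omega> * real k \<le> 2048 * q"
    proof -
      have "100000 * \<omega> * real k * 1 \<le> 100000 * \<omega> * real k * ?r^2"
        using \<omega> r1 by (intro mult_left_mono) auto
      then show ?thesis using kq by (simp add: mult_ac)
    qed
    have k_le_q: "100000 * real k \<le> 2048 * q"
    proof -
      have "100000 * real k * 1 \<le> 100000 * real k * \<omega>" using \<omega> by (intro mult_left_mono) auto
      then show ?thesis using k\<omega> by (simp add: mult_ac)
    qed
    have kM: "k \<le> M"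
    proof -
      have "q * 1 \<le> q * (q * (?n - 1) / 2)"
      proof (intro mult_left_mono)
        have "32 * 1 \<le> q * (?n - 1)" using q32 n by (intro mult_mono) auto
        then show "1 \<le> q * (?n - 1) / 2" by simp
      qed (use q0 in simp)
      then have "q \<le> real M" unfolding M' by (simp add: power2_eq_square)
      then have "real k \<le> real M" using k_le_q q0 by linarith
      then show ?thesis by simp
    qed
    define \<T> where "\<T> = {G. \<forall>c\<in>?C. real (card (G \<inter> c)) \<le> p * real (card c) + t}"
    define \<tau> where "\<tau> = average \<G> (\<lambda>G. of_bool (G \<notin> \<T>))"
    have t0: "t \<ge> 0" using q0 by (simp add: t_def)
    have \<tau>_le: "\<tau> \<le> 1 / (3 * ?n)"
    proof -
      \<comment> \<open>With \<open>l = 4 / q\<close> the exponent of the tail bound is \<open>4 n - 8 n\<close>, which beats the number of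
        bipartitions. What remains is at most \<open>exp (- 3 n)\<close>; the weaker bound stated here suffices,
        as \<open>\<omega>\<close> and \<open>k \<omega>\<close> are at most \<open>n\<close>.\<close>
      have "\<tau> \<le> real (card ?C) * exp ((4 / q)^2 * p * (?n^2 / 4) - 4 / q * t)"
      proof -
        have "(G \<notin> \<T>) = (\<exists>c\<in>?C. real (card (G \<inter> c)) > p * real (card c) + t)" for G
          by (auto simp: \<T>_def not_le)
        then show ?thesis
          unfolding \<tau>_def \<G>_def
          using union_tail_bound[where V = ?V and \<C> = ?C and A = "?n^2 / 4" and m = M and l = "4 / q" and t = t,
              OF fV card_cut_sets_le(1) cut_sets_subset card_cut_le] MN cV q0 q32
          unfolding pMN by simp
      qed
      also have "(4 / q)^2 * p * (?n^2 / 4) - 4 / q * t = - (4 * ?n)"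
      proof -
        have "(4 / q)^2 * p * (?n^2 / 4) = 4 * ?n * (p * ?n / q^2)"
          by (simp add: power_divide power2_eq_square)
        also have "\<dots> = 4 * ?n" using q0 unfolding q2[symmetric] by simp
        finally show ?thesis using q0 by (simp add: t_def)
      qed
      also have "real (card ?C) * exp (- (4 * ?n)) \<le> exp ?n * exp (- (4 * ?n))"
      proof (rule mult_right_mono)
        have "real (card ?C) \<le> 2 ^ n" using card_cut_sets_le(2)[of n] by (metis of_nat_le_iff of_nat_numeral of_nat_power)
        also have "\<dots> \<le> exp 1 ^ n" using exp_ge_add_one_self[of 1] by (intro power_mono) auto
        also have "\<dots> = exp ?n" by (simp add: exp_of_nat_mult[symmetric])
        finally show "real (card ?C) \<le> exp ?n" .
      qed simp
      also have "\<dots> = inverse (exp (3 * ?n))" by (simp add: exp_add[symmetric] exp_minus[symmetric])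
      also have "\<dots> \<le> 1 / (3 * ?n)"
      proof -
        have "3 * ?n \<le> exp (3 * ?n)" using exp_ge_add_one_self[of "3 * ?n"] by linarith
        then show ?thesis using n by (simp add: inverse_eq_divide frac_le)
      qed
      finally show ?thesis .
    qed
    have \<tau>0: "\<tau> \<ge> 0" by (simp add: \<tau>_def average_def sum_nonneg)
    have main: "?r / 2 * average \<G> (\<lambda>G. of_bool (G \<in> \<E> \<inter> \<T>)) \<le> real k * t / real M + real k * \<tau>"
      unfolding \<G>_def \<tau>_def
    proof (rule competing_maximizer_probability_le[OF fV card_cut_sets_le(1) cut_sets_nonempty cut_sets_subset kM])
      show "M > 0" using Mpos by simp
      show "2 * M \<le> card ?V" using MN cV by simp
      show "t \<ge> 0" by (rule t0)
      show "?r \<ge> 1" by (rule r1)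
      show "\<E> \<inter> \<T> \<subseteq> \<T>" by simp
      show "real (card (G \<inter> c)) \<le> real M / real (card ?V) * real (card c) + t"
        if "G \<in> \<T>" "c \<in> ?C" for G c
        unfolding pMN using that by (simp add: \<T>_def)
      fix G assume G: "G \<in> subsets_of_card ?V M \<inter> (\<E> \<inter> \<T>)"
      then have GV: "G \<subseteq> ?V" and cG: "card G = M" and T: "G \<in> \<T>"
        by (auto simp: subsets_of_card_def)
      obtain P where P: "P \<in> bipartitions n" "gap n G P = r - 1"
        and dist: "s\<^sub>0 \<le> real (dist_bip P (opt_bipartition L n G))"
        using G by (auto simp: \<E>_def dist_to_opt_def)
      define Q where "Q = opt_bipartition L n G"
      have Q: "Q \<in> bipartitions n" "card (crossing_edges G Q) = max_cut n G"
        using optimal_opt_bipartition[OF L, of G] by (auto simp: optimal_def Q_def)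
      define c d where "c = crossing_edges ?V Q" and "d = crossing_edges ?V P"
      have cd: "c \<in> ?C" "d \<in> ?C" using P Q by (auto simp: c_def d_def cut_sets_def)
      have c_opt: "card (G \<inter> c) = max_meet ?C G"
        using Q(2) by (simp add: c_def crossing_edges_eq_Int[OF GV] max_cut_eq_max_meet[OF GV])
      have d_opt: "real (max_meet ?C G) - (?r - 1) \<le> real (card (G \<inter> d))"
        using P(2) r by (simp add: gap_def d_def crossing_edges_eq_Int[OF GV] max_cut_eq_max_meet[OF GV])
      define s where "s = real (dist_bip P Q)"
      have ss: "s\<^sub>0 \<le> s" using dist by (simp add: s_def Q_def)
      have X: "sym_diff c d = crossing_edges ?V (merge_bip P Q)"
        unfolding c_def d_def sym_diff_crossing_edges[OF P(1) Q(1), symmetric] by blast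
      have XC: "sym_diff c d \<in> ?C"
        unfolding X cut_sets_def using merge_bip_mem[OF P(1) Q(1)] by blast
      have sX: "s * ?n / 2 \<le> real (card (sym_diff c d))"
        using card_sym_diff_ge[OF P(1) Q(1)] unfolding s_def X sym_diff_crossing_edges[OF P(1) Q(1)] .
      have "16 * q \<le> s"
      proof -
        have "16 * q * q \<le> 100000 * ?n" using qn q0 n by (simp add: power2_eq_square)
        then have "16 * q \<le> 100000 * (?n / q)" using q0 by (simp add: pos_le_divide_eq)
        then show ?thesis using s0_ge ss by linarith
      qed
      then have weight: "s / (16 * ?n) \<le> real (card (G - sym_diff c d)) / real M
          * (real (card (sym_diff c d - G)) / real (card (?V - G)))"
        using T XC n unfolding \<T>_def t_def
        by (intro symdiff_weight_ge[OF cut_sets_subset[OF XC] GV cG M p q32 q2 _ sX card_cut_le[OF XC]]) auto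
      have "64 * ?r^2 = y * (s\<^sub>0 / (16 * ?n))"
        using s0_pos n by (simp add: y_def)
      also have "\<dots> \<le> real k * (s / (16 * ?n))"
        using ky(1) ss s0_pos y1 n by (intro mult_mono divide_right_mono) auto
      also have "\<dots> \<le> real k * (real (card (G - sym_diff c d)) / real M
          * (real (card (sym_diff c d - G)) / real (card (?V - G))))"
        by (rule mult_left_mono[OF weight]) simp
      finally show "\<exists>c\<in>?C. \<exists>d\<in>?C. card (G \<inter> c) = max_meet ?C G \<and>
          real (max_meet ?C G) - (?r - 1) \<le> real (card (G \<inter> d)) \<and>
          64 * ?r^2 \<le> real k * (real (card (G - sym_diff c d)) / real M
                             * (real (card (sym_diff c d - G)) / real (card (?V - G))))"
        using cd c_opt d_opt by blast
    qed
    have loss: "\<omega> * (real k * t / real M) \<le> 1 / 5"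
    proof -
      have "real k * t / real M = real k * (4 * (?n / (?n - 1)) / q)"
        unfolding t_def M' using q0 n by (simp add: field_simps power2_eq_square)
      also have "\<dots> \<le> real k * (4 * 2 / q)"
        using n q0 by (intro mult_left_mono divide_right_mono) (auto simp: pos_divide_le_eq)
      finally have "\<omega> * (real k * t / real M) \<le> \<omega> * (real k * (4 * 2 / q))"
        using \<omega> by (intro mult_left_mono) auto
      also have "\<dots> = \<omega> * real k * 8 / q" by simp
      also have "\<dots> \<le> 1 / 5"
        using k\<omega> q0 by (simp add: pos_divide_le_eq)
      finally show ?thesis .
    qed
    have \<omega>q: "\<omega> \<le> q"
      using small mult_left_mono[OF r41, of "200000 * \<omega>"] \<omega> by linarith
    have q_le: "q \<le> ?n"
    proof -
      have "1 * q \<le> q * q" using q32 by (intro mult_right_mono) auto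
      then show ?thesis using qn n by (simp add: power2_eq_square)
    qed
    have rare: "\<omega> * (real k * \<tau>) \<le> 1 / 100"
    proof -
      have "\<omega> * real k \<le> 2048 / 100000 * ?n" using k\<omega> q_le by linarith
      then have "\<omega> * real k * \<tau> \<le> (2048 / 100000 * ?n) * (1 / (3 * ?n))"
        by (rule mult_mono[OF _ \<tau>_le _ \<tau>0]) simp
      also have "\<dots> \<le> 1 / 100" using n by simp
      finally show ?thesis by (simp add: mult.assoc)
    qed
    have rare': "\<omega> * \<tau> \<le> 1 / 3"
    proof -
      have "\<omega> \<le> ?n" using \<omega>q q_le by linarith
      then have "\<omega> * \<tau> \<le> ?n * (1 / (3 * ?n))"
        by (rule mult_mono[OF _ \<tau>_le _ \<tau>0]) simp
      then show ?thesis using n by simp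
    qed
    let ?b = "average \<G> (\<lambda>G. of_bool (G \<in> \<E> \<inter> \<T>))"
    have b0: "0 \<le> ?b" by (simp add: average_def sum_nonneg)
    have "\<omega> * ?b / 2 \<le> \<omega> * (?r / 2 * ?b)"
      using mult_right_mono[OF r1, of "\<omega> * ?b / 2"] \<omega> b0 by (simp add: mult_ac)
    also have "\<dots> \<le> \<omega> * (real k * t / real M + real k * \<tau>)"
      using main \<omega> by (intro mult_left_mono) auto
    also have "\<dots> \<le> 1 / 5 + 1 / 100"
      using loss rare by (simp only: distrib_left)
    finally have wb: "\<omega> * ?b \<le> 21 / 50" by simp
    have "average \<G> (\<lambda>G. of_bool (G \<in> \<E>)) \<le> average \<G> (\<lambda>G. of_bool (G \<in> \<E> \<inter> \<T>) + of_bool (G \<notin> \<T>))"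
      by (rule average_mono) auto
    also have "\<dots> = ?b + \<tau>" by (simp only: average_add \<tau>_def)
    finally have "\<omega> * average \<G> (\<lambda>G. of_bool (G \<in> \<E>)) \<le> \<omega> * (?b + \<tau>)"
      using \<omega> by (intro mult_left_mono) auto
    also have "\<dots> \<le> 1" using wb rare' by (simp only: distrib_left)
    finally show ?thesis using \<omega> by (simp add: inverse_eq_divide pos_le_divide_eq mult.commute)
  qed
  then show ?thesis using prob unfolding \<E>_def s\<^sub>0_def by simp
qed

theorem theorem1p4:
  shows "\<exists>C>1::real.
    \<forall>(L :: nat \<Rightarrow> (nat set \<times> nat set) list) (p :: nat \<Rightarrow> real) (M :: nat \<Rightarrow> nat)
      (r :: nat \<Rightarrow> nat) (\<omega> :: nat \<Rightarrow> real).
      (\<forall>n. set (L n) = bipartitions n) \<longrightarrow>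
      (\<lambda>n. 1 / real n) \<lless> p \<longrightarrow>
      (\<forall>\<^sub>F n in sequentially. 0 < p n \<and> p n \<le> 1 / 2) \<longrightarrow>
      (\<forall>\<^sub>F n in sequentially. real (M n) = p n * real (n choose 2)) \<longrightarrow>
      (\<forall>\<^sub>F n in sequentially. r n \<ge> 1) \<longrightarrow>
      (\<lambda>n. real (r n)) \<lless> (\<lambda>n. (p n * real n) powr (1 / 8)) \<longrightarrow>
      filterlim \<omega> at_top sequentially \<longrightarrow>
      (\<forall>\<^sub>F n in sequentially.
        measure_pmf.prob (random_graph n (M n))
          {G. \<exists>P\<in>bipartitions n.
             gap n G P = r n - 1 \<and>
             real (dist_to_opt (L n) n G P)
               \<ge> C * \<omega> n * real (r n) ^ 4 * sqrt (real n * inverse (p n))}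
        \<le> inverse (\<omega> n))"
proof (intro exI[of _ 100000] conjI allI impI)
  fix L :: "nat \<Rightarrow> (nat set \<times> nat set) list" and p \<omega> :: "nat \<Rightarrow> real" and M r :: "nat \<Rightarrow> nat"
  assume L: "\<forall>n. set (L n) = bipartitions n"
    and sparse: "(\<lambda>n. 1 / real n) \<lless> p"
    and p: "\<forall>\<^sub>F n in sequentially. 0 < p n \<and> p n \<le> 1 / 2"
    and M: "\<forall>\<^sub>F n in sequentially. real (M n) = p n * real (n choose 2)"
    and r: "\<forall>\<^sub>F n in sequentially. r n \<ge> 1"
    and \<omega>: "filterlim \<omega> at_top sequentially"
  have "(\<lambda>n. 1 / real n / p n) \<longlonglongrightarrow> 0" using sparse by (simp add: much_less_def)
  then have "\<forall>\<^sub>F n in sequentially. 1 / real n / p n < 1 / 1024" by (rule order_tendstoD) simp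
  then have pn: "\<forall>\<^sub>F n in sequentially. 1024 \<le> p n * real n"
    using p eventually_gt_at_top[of 0]
    by eventually_elim (simp add: field_simps)
  have "\<forall>\<^sub>F n in sequentially. \<omega> n \<ge> 1" using \<omega> by (simp add: filterlim_at_top)
  with p M r pn
  show "\<forall>\<^sub>F n in sequentially.
      measure_pmf.prob (random_graph n (M n))
        {G. \<exists>P\<in>bipartitions n.
           gap n G P = r n - 1 \<and>
           real (dist_to_opt (L n) n G P)
             \<ge> 100000 * \<omega> n * real (r n) ^ 4 * sqrt (real n * inverse (p n))}
      \<le> inverse (\<omega> n)"
  proof eventually_elim
    case (elim n)
    then show ?case using L by (intro prob_far_near_optimal_le) auto
  qed
qed simp

end
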